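(* Let $\ell\in\mathbb N$, $\epsilon>0$, $R>0$, and $s_0=\frac{16(R+\epsilon)\ell}{\epsilon^2}$. For any rate $R$ $s$-folded Reed–Solomon code $\mathcal C\subseteq(\mathbb F_q^s)^n$ with $s>s_0$, and any lists $L_1,\dots,L_n\subseteq\mathbb F_q^s$ with $|L_i|=\ell$ for all $i$, $$\bigl|\{c\in\mathcal C\mid\Delta(c,L_1\times\cdots\times L_n)\le1-R-\epsilon\}\bigr|\le O\!\left(\frac{\ell}{\epsilon^2}\right)\cdot\ell^{\,2\ln\left(2e\ell/(R+\epsilon)\right)\cdot\frac{R+\epsilon}{\epsilon}}.$$
   Context: Folded Reed–Solomon codes: let $n,k,s$ be positive integers, $\mathbb F_q$ a finite field with $q>sn$, $\gamma$ an element of the field, and $\alpha_1,\dots,\alpha_n\in\mathbb F_q$ distinct elements such that $\alpha_i\gamma^t\ne\alpha_j$ for all $i\ne j$ and $t<s$. The $s$-folded Reed–Solomon code with message length $k$ on $(\alpha_1,\dots,\alpha_n)$ is the set of all words in $(\mathbb F_q^s)^n$ whose $i$-th coordinate is $(f(\alpha_i),f(\alpha_i\gamma),\dots,f(\alpha_i\gamma^{s-1}))$, for $f\in\mathbb F_q[x]$ with $\deg f<k$. The rate of a code $\mathcal C\subseteq\Sigma^n$ is $\log_{|\Sigma|}|\mathcal C|/n$. Fractional Hamming distance: $\Delta(x,y)=|\{i\in[n]:x_i\ne y_i\}|/n$ and $\Delta(x,S)=\min_{y\in S}\Delta(x,y)$; so $\Delta(c,L_1\times\cdots\times L_n)=|\{i: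 c_i\notin L_i\}|/n$.
   Formalization: The formal theorem also assumes that γ and all α_i are nonzero and that γ has multiplicative order at least min(k, sn); without this the bound fails (e.g. γ=1, ℓ=1, s=200, k=n/2, ε=1/8, all lists {0}). It takes ℓ ≥ 1. *)

theory Defs
  imports Complex_Main "HOL-Algebra.Polynomials" "HOL-Algebra.Multiplicative_Group"
    "HOL-Library.FuncSet"
begin

text \<open>
  Finite fields are HOL-Algebra structures, not type-class types: the absolute constant of the
  theorem must be chosen before the field, and HOL cannot quantify over types inside a formula.
  A word in \<open>\<Sigma>\<^sup>n\<close> is an element of \<open>{..<n} \<rightarrow>\<^sub>E \<Sigma>\<close>, so coordinates are numbered from \<open>0\<close>.
\<close>

definition words :: "nat \<Rightarrow> 'b set \<Rightarrow> (nat \<Rightarrow> 'b) set" where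
  "words n \<Sigma> = ({..<n} \<rightarrow>\<^sub>E \<Sigma>)"

definition code_rate :: "'b set \<Rightarrow> nat \<Rightarrow> (nat \<Rightarrow> 'b) set \<Rightarrow> real" where
  "code_rate \<Sigma> n C = log (real (card \<Sigma>)) (real (card C)) / real n"

definition rel_dist :: "nat \<Rightarrow> (nat \<Rightarrow> 'b) \<Rightarrow> (nat \<Rightarrow> 'b) \<Rightarrow> real" where
  "rel_dist n x y = real (card {i \<in> {..<n}. x i \<noteq> y i}) / real n"

definition rel_dist_set :: "nat \<Rightarrow> (nat \<Rightarrow> 'b) \<Rightarrow> (nat \<Rightarrow> 'b) set \<Rightarrow> real" where
  "rel_dist_set n x S = Min (rel_dist n x ` S)"

lemma rel_dist_set_product:
  assumes "\<And>i. i < n \<Longrightarrow> L i \<noteq> {}"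
  shows "rel_dist_set n x (PiE {..<n} L) = real (card {i \<in> {..<n}. x i \<notin> L i}) / real n"
  unfolding rel_dist_set_def
proof (rule Min_eqI)
  have "rel_dist n x ` PiE {..<n} L \<subseteq> (\<lambda>m. real m / real n) ` {..n}"
  proof
    fix r assume "r \<in> rel_dist n x ` PiE {..<n} L"
    then obtain y where r: "r = rel_dist n x y" by blast
    have "card {i \<in> {..<n}. x i \<noteq> y i} \<le> card {..<n}" by (rule card_mono) auto
    then show "r \<in> (\<lambda>m. real m / real n) ` {..n}" by (auto simp: r rel_dist_def)
  qed
  then show "finite (rel_dist n x ` PiE {..<n} L)" by (rule finite_subset) simp
next
  fix r assume "r \<in> rel_dist n x ` PiE {..<n} L"
  then obtain y where y: "y \<in> PiE {..<n} L" and r: "r = rel_dist n x y" by blast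
  have "card {i \<in> {..<n}. x i \<notin> L i} \<le> card {i \<in> {..<n}. x i \<noteq> y i}"
    using y by (intro card_mono) (auto simp: PiE_def Pi_def)
  then show "real (card {i \<in> {..<n}. x i \<notin> L i}) / real n \<le> r"
    by (simp add: r rel_dist_def divide_right_mono)
next
  define y where "y = (\<lambda>i\<in>{..<n}. if x i \<in> L i then x i else (SOME v. v \<in> L i))"
  have y: "y i \<in> L i" if "i < n" for i
    using assms[OF that] that by (auto simp: y_def some_in_eq)
  have "{i \<in> {..<n}. x i \<noteq> y i} = {i \<in> {..<n}. x i \<notin> L i}"
  proof (intro Collect_cong conj_cong refl)
    fix i assume "i \<in> {..<n}"
    then show "(x i \<noteq> y i) = (x i \<notin> L i)" using y[of i] by (auto simp: y_def)
  qed
  moreover have "y \<in> PiE {..<n} L"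
    using y by (auto simp: PiE_def Pi_def y_def extensional_def)
  ultimately show "real (card {i \<in> {..<n}. x i \<notin> L i}) / real n \<in> rel_dist n x ` PiE {..<n} L"
    by (intro image_eqI[of _ _ y]) (simp_all add: rel_dist_def)
qed

text \<open>
  The last three conditions of \<open>folded_rs_params\<close> are tacit in the usual description of these
  codes, where \<open>\<gamma>\<close> generates the multiplicative group and the evaluation points are units; without
  them the list-size bound is false (e.g. \<open>\<gamma> = 1\<close> gives a Reed-Solomon code with every symbol
  repeated \<open>s\<close> times). Given \<open>s n < q\<close>, a generator \<open>\<gamma>\<close> always satisfies the order condition; so
  does every \<open>\<gamma>\<close> of order at least \<open>k\<close>.
\<close>

definition folded_rs_params ::
    "('a, 'm) ring_scheme \<Rightarrow> nat \<Rightarrow> nat \<Rightarrow> nat \<Rightarrow> 'a \<Rightarrow> (nat \<Rightarrow> 'a) \<Rightarrow> bool" where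
  "folded_rs_params F n k s \<gamma> \<alpha> \<longleftrightarrow>
     field F \<and> finite (carrier F) \<and> 0 < n \<and> 0 < k \<and> 0 < s \<and> s * n < card (carrier F) \<and>
     \<gamma> \<in> carrier F \<and> \<alpha> \<in> {..<n} \<rightarrow> carrier F \<and> inj_on \<alpha> {..<n} \<and>
     (\<forall>i<n. \<forall>j<n. \<forall>t<s. i \<noteq> j \<longrightarrow> \<alpha> i \<otimes>\<^bsub>F\<^esub> (\<gamma> [^]\<^bsub>F\<^esub> t) \<noteq> \<alpha> j) \<and>
     (\<forall>i<n. \<alpha> i \<noteq> \<zero>\<^bsub>F\<^esub>) \<and> \<gamma> \<noteq> \<zero>\<^bsub>F\<^esub> \<and>
     min k (s * n) \<le> group.ord (mult_of F) \<gamma>"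

text \<open>
  Polynomials are HOL-Algebra coefficient lists; the zero polynomial \<open>[]\<close> has degree \<open>0\<close> there,
  which agrees with the convention \<open>deg 0 < k\<close> because \<open>k\<close> is positive.
\<close>

definition folded_rs ::
    "('a, 'm) ring_scheme \<Rightarrow> nat \<Rightarrow> nat \<Rightarrow> nat \<Rightarrow> 'a \<Rightarrow> (nat \<Rightarrow> 'a) \<Rightarrow> (nat \<Rightarrow> nat \<Rightarrow> 'a) set" where
  "folded_rs F n k s \<gamma> \<alpha> =
     (\<lambda>f. \<lambda>i\<in>{..<n}. \<lambda>t\<in>{..<s}. ring.eval F f (\<alpha> i \<otimes>\<^bsub>F\<^esub> (\<gamma> [^]\<^bsub>F\<^esub> t))) `
       {f \<in> carrier (univ_poly F (carrier F)). degree f < k}"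

end

theory Submission
  imports Defs
begin

text \<open>
  Let \<open>H i\<close> be the space of messages whose \<open>i\<close>-th symbol vanishes, and \<open>\<rho> = R + \<epsilon>\<close>. Folding makes these
  spaces a subspace design: a space \<open>U\<close> of messages of dimension at most \<open>D\<close> satisfies
  \<open>\<Sum>i<n. dim (U \<inter> H i) \<le> \<tau> n dim U\<close> with \<open>\<tau> = k / (n (s - D + 1))\<close>, and the bound on \<open>s\<close> keeps
  \<open>\<tau>\<close> below \<open>R + \<epsilon> / 8\<close> for some \<open>D\<close> of order \<open>l / \<epsilon>\<close>. Everything else uses this property alone.

  An affinely independent subset of the list with \<open>D + 1\<close> elements would agree with the lists too often,
  so the list \<open>S\<close> lies in a translate of a space of dimension below \<open>D\<close>. Let \<open>N\<close> be its size. By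
  a Brascamp-Lieb inequality the design property passes from dimensions to entropies: writing \<open>N i v\<close> for
  the number of list elements with \<open>i\<close>-th symbol \<open>v\<close>,
  \<open>\<Sum>i<n. \<Sum>v. N i v ln (N i v) \<le> \<tau> n N ln N\<close>. As the symbols \<open>v \<in> L i\<close> already account for at least
  \<open>\<rho> n N\<close> occurrences, convexity yields \<open>\<rho> ln (\<rho> N / l) \<le> \<tau> ln N\<close>, that is
  \<open>N \<le> (l / \<rho>) powr (\<rho> / (\<rho> - \<tau>))\<close>, which is enough for \<open>l \<ge> 2\<close>. For \<open>l = 1\<close> an induction on the
  dimension gives the linear bound \<open>N \<le> 1 + dim U (1 - \<rho>) / (\<rho> - \<tau>)\<close>, hence \<open>N = O(1 / \<epsilon>\<^sup>2)\<close>.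
\<close>

subsection \<open>Entropy of a partition and a Brascamp-Lieb inequality\<close>

text \<open>The design property is available only up to dimension \<open>D\<close>, because \<tau>
  grows with \<open>D\<close> through s - D + 1. Hence the list has to be confined to a small
  subspace before the entropy argument can treat it as a whole. Dimension can be exchanged for
  entropy because the conditional entropy given a coset is monotone and supermodular in the
  subspace: a weighted dimension inequality that holds on all subspaces passes to every function
  with these two properties. The case \<open>l = 1\<close> needs its own argument because the
  claimed factor l powr (...) is then 1, whereas the entropy bound (1 / \<rho>) powr (\<rho> /
  (\<rho> - \<tau>)) may be exponential in 1 / \<epsilon>. Linear algebra is done by counting: all
  spaces are finite over a field with q elements, so dimension is the exponent of a cardinality and
  an injection yields a dimension inequality. In this form the folded Wronskian determinant becomes
  an injectivity statement about tuples of polynomials.\<close>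

lemma sum_class_le_one:
  assumes "equiv S r" "finite S" "T \<subseteq> S" "\<And>x y. x \<in> T \<Longrightarrow> y \<in> T \<Longrightarrow> (x, y) \<in> r"
  shows "(\<Sum>x\<in>T. 1 / real (card (r `` {x}))) \<le> 1"
proof (cases "T = {}")
  case False
  then obtain x0 where x0: "x0 \<in> T" by blast
  have cls: "r `` {x} = r `` {x0}" if "x \<in> T" for x
    using equiv_class_eq[OF assms(1) assms(4)[OF that x0]] .
  have fin: "finite (r `` {x0})"
    using assms(1,2) by (meson equiv_type finite_subset Image_subset)
  have sub: "T \<subseteq> r `` {x0}" using assms(4)[OF x0] by auto
  then have "card T \<le> card (r `` {x0})" using fin card_mono by blast
  moreover have "(\<Sum>x\<in>T. 1 / real (card (r `` {x}))) = card T / card (r `` {x0})"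
    by (simp add: cls)
  moreover have "card (r `` {x0}) > 0"
    using fin x0 sub by (auto simp: card_gt_0_iff)
  ultimately show ?thesis by (simp add: divide_le_eq)
qed simp

text \<open>Divided by \<open>card S\<close>, this is the entropy of a uniform element of \<open>S\<close> given its class, so
  supermodularity is strong subadditivity of Shannon entropy.\<close>

definition class_entropy :: "'v set \<Rightarrow> ('v \<times> 'v) set \<Rightarrow> real" where
  "class_entropy S r = (\<Sum>x\<in>S. ln (real (card (r `` {x}))))"

lemma class_entropy_mono:
  assumes "finite S" "equiv S a" "equiv S b" "a \<subseteq> b"
  shows "class_entropy S a \<le> class_entropy S b"
  unfolding class_entropy_def
proof (rule sum_mono)
  fix x assume "x \<in> S"
  have "b `` {x} \<subseteq> S" using Image_subset[OF equiv_type[OF assms(3)]] .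
  then have "finite (b `` {x})" using assms(1) by (rule finite_subset)
  moreover have "x \<in> a `` {x}" using equiv_class_self[OF assms(2) \<open>x \<in> S\<close>] .
  moreover have "a `` {x} \<subseteq> b `` {x}" using assms(4) by blast
  ultimately have "0 < card (a `` {x})" "card (a `` {x}) \<le> card (b `` {x})"
    by (auto simp only: card_gt_0_iff intro: card_mono finite_subset)
  then show "ln (real (card (a `` {x}))) \<le> ln (real (card (b `` {x})))" by simp
qed

text \<open>Gibbs' inequality: ln z \<le> z - 1, applied to the ratio of the four class sizes,
  reduces the claim to \<Sum>x. |a x| |b x| / (|(a \<inter> b) x| |d x|) \<le> |S|. The relation
  \<open>d\<close> is only asked to contain \<open>a\<close> and \<open>b\<close>, since for cosets
  restricted to an arbitrary \<open>S\<close> the relation of a sum of subspaces can be coarser than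
  the join of the two relations.\<close>

lemma class_entropy_supermodular:
  assumes fin: "finite S" and a: "equiv S a" and b: "equiv S b" and d: "equiv S d"
    and ad: "a \<subseteq> d" and bd: "b \<subseteq> d"
  shows "class_entropy S a + class_entropy S b \<le> class_entropy S (a \<inter> b) + class_entropy S d"
proof -
  have ab: "equiv S (a \<inter> b)"
  proof (rule equivI)
    show "a \<inter> b \<subseteq> S \<times> S" using equiv_type[OF a] by blast
    show "refl_on S (a \<inter> b)"
      using equiv_class_self[OF a] equiv_class_self[OF b] by (auto intro!: refl_onI)
    show "sym (a \<inter> b)" "trans (a \<inter> b)"
      using a b by (simp_all add: equiv_def sym_Int trans_Int)
  qed
  have pos: "finite (r `` {x}) \<and> card (r `` {x}) > 0" if "equiv S r" "x \<in> S" for r x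
  proof -
    have "finite (r `` {x})"
      using that fin by (meson equiv_type finite_subset Image_subset)
    then show ?thesis using equiv_class_self[OF that] by (auto simp: card_gt_0_iff)
  qed
  define q where "q x = 1 / real (card ((a \<inter> b) `` {x})) * (1 / real (card (d `` {x})))" for x
  have ln_ratio: "ln (w * x * (1 / y * (1 / z))) = ln w + ln x - ln y - ln z"
    if "0 < w" "0 < x" "0 < y" "0 < z" for w x y z :: real
    using that by (simp add: ln_mult ln_div)
  have le: "ln (real (card (a `` {x}))) + ln (real (card (b `` {x})))
      - ln (real (card ((a \<inter> b) `` {x}))) - ln (real (card (d `` {x})))
      \<le> real (card (a `` {x})) * real (card (b `` {x})) * q x - 1" if x: "x \<in> S" for x
  proof -
    note p = pos[OF a x] pos[OF b x] pos[OF ab x] pos[OF d x]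
    have "ln (real (card (a `` {x})) * real (card (b `` {x})) * q x)
      = ln (real (card (a `` {x}))) + ln (real (card (b `` {x})))
      - ln (real (card ((a \<inter> b) `` {x}))) - ln (real (card (d `` {x})))"
      unfolding q_def using p by (intro ln_ratio) auto
    moreover have "real (card (a `` {x})) * real (card (b `` {x})) * q x > 0"
      using p by (simp add: q_def)
    ultimately show ?thesis using ln_le_minus_one by metis
  qed
  have sub: "r `` {x} \<subseteq> S" if "equiv S r" for r x
    using that by (meson equiv_type Image_subset)
  have ind: "real (card (r `` {x})) = (\<Sum>y\<in>S. if (x, y) \<in> r then 1 else 0)" if "equiv S r" for r x
  proof -
    have "r `` {x} = {y \<in> S. (x, y) \<in> r}" using sub[OF that] by auto
    then show ?thesis using fin by (simp add: sum.If_cases Int_def)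
  qed
  have symr: "(x, y) \<in> r \<longleftrightarrow> (y, x) \<in> r" if "equiv S r" for r x y
    using that by (auto simp: equiv_def sym_def)
  have trr: "(x, y) \<in> r \<Longrightarrow> (y, z) \<in> r \<Longrightarrow> (x, z) \<in> r" if "equiv S r" for r x y z
    using that by (auto simp: equiv_def trans_def)
  \<comment> \<open>Expand |a x| |b x| as the number of pairs (y, z) with x related to y by
    \<open>a\<close> and to z by \<open>b\<close>, and fix (y, z): the possible x lie in a single
    class of a \<inter> b and contribute at most 1 / |d y| in total.\<close>
  have "(\<Sum>x\<in>S. real (card (a `` {x})) * real (card (b `` {x})) * q x)
     = (\<Sum>x\<in>S. \<Sum>y\<in>S. \<Sum>z\<in>S. if (x, y) \<in> a \<and> (x, z) \<in> b then q x else 0)"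
    unfolding ind[OF a] ind[OF b] sum_product sum_distrib_right
    by (intro sum.cong refl) (auto simp: sum_distrib_right intro!: sum.cong)
  also have "\<dots> = (\<Sum>y\<in>S. \<Sum>x\<in>S. \<Sum>z\<in>S. if (x, y) \<in> a \<and> (x, z) \<in> b then q x else 0)"
    by (rule sum.swap)
  also have "\<dots> = (\<Sum>y\<in>S. \<Sum>z\<in>S. \<Sum>x\<in>S. if (x, y) \<in> a \<and> (x, z) \<in> b then q x else 0)"
    by (intro sum.cong refl sum.swap)
  also have "\<dots> \<le> (\<Sum>y\<in>S. \<Sum>z\<in>S. if (y, z) \<in> d then 1 / real (card (d `` {y})) else 0)"
  proof (intro sum_mono)
    fix y z assume yz: "y \<in> S" "z \<in> S"
    define T where "T = {x \<in> S. (x, y) \<in> a \<and> (x, z) \<in> b}"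
    have "(\<Sum>x\<in>S. if (x, y) \<in> a \<and> (x, z) \<in> b then q x else 0) = (\<Sum>x\<in>T. q x)"
      using fin by (simp add: T_def sum.If_cases Int_def)
    also have "\<dots> = (\<Sum>x\<in>T. 1 / real (card ((a \<inter> b) `` {x}))) * (1 / real (card (d `` {y})))"
      unfolding sum_distrib_right q_def
    proof (intro sum.cong refl)
      fix x assume "x \<in> T"
      then have "(x, y) \<in> d" using ad by (auto simp: T_def)
      from equiv_class_eq[OF d this]
      show "1 / real (card ((a \<inter> b) `` {x})) * (1 / real (card (d `` {x}))) =
        1 / real (card ((a \<inter> b) `` {x})) * (1 / real (card (d `` {y})))" by simp
    qed
    also have "\<dots> \<le> (if (y, z) \<in> d then 1 / real (card (d `` {y})) else 0)"
    proof (cases "T = {}")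
      case False
      then obtain x where "(x, y) \<in> a" "(x, z) \<in> b" by (auto simp: T_def)
      then have "(y, z) \<in> d" using ad bd symr[OF d] trr[OF d] by blast
      moreover have "(\<Sum>x\<in>T. 1 / real (card ((a \<inter> b) `` {x}))) \<le> 1"
      proof (rule sum_class_le_one[OF ab fin])
        show "T \<subseteq> S" by (auto simp: T_def)
        fix x x' assume "x \<in> T" "x' \<in> T"
        then show "(x, x') \<in> a \<inter> b"
          unfolding T_def using symr[OF a] symr[OF b] trr[OF a] trr[OF b] by blast
      qed
      ultimately show ?thesis using mult_right_mono[of _ 1 "1 / real (card (d `` {y}))"] by simp
    qed simp
    finally show "(\<Sum>x\<in>S. if (x, y) \<in> a \<and> (x, z) \<in> b then q x else 0)
      \<le> (if (y, z) \<in> d then 1 / real (card (d `` {y})) else 0)" .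
  qed
  also have "\<dots> = (\<Sum>y\<in>S. real (card (d `` {y})) * (1 / real (card (d `` {y}))))"
    unfolding ind[OF d] sum_distrib_right by (intro sum.cong refl) auto
  also have "\<dots> = (\<Sum>y\<in>S. 1)"
    using pos[OF d] by (intro sum.cong refl) (metis mult.right_neutral nonzero_mult_div_cancel_left
        of_nat_0_less_iff order_less_irrefl times_divide_eq_right)
  finally have key: "(\<Sum>x\<in>S. real (card (a `` {x})) * real (card (b `` {x})) * q x) \<le> card S"
    by simp
  have "class_entropy S a + class_entropy S b - class_entropy S (a \<inter> b) - class_entropy S d
    = (\<Sum>x\<in>S. ln (real (card (a `` {x}))) + ln (real (card (b `` {x})))
      - ln (real (card ((a \<inter> b) `` {x}))) - ln (real (card (d `` {x}))))"
    by (simp add: class_entropy_def sum.distrib sum_subtractf)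
  also have "\<dots> \<le> (\<Sum>x\<in>S. real (card (a `` {x})) * real (card (b `` {x})) * q x - 1)"
    by (intro sum_mono le)
  also have "\<dots> \<le> 0" using key by (simp add: sum_subtractf)
  finally show ?thesis by simp
qed

section \<open>Brascamp-Lieb inequality in a finite modular lattice\<close>

locale dimension_lattice =
  fixes \<U> :: "'v set set" and join :: "'v set \<Rightarrow> 'v set \<Rightarrow> 'v set" and dim :: "'v set \<Rightarrow> nat"
  assumes finite_lattice: "finite \<U>"
    and inter_closed: "A \<in> \<U> \<Longrightarrow> B \<in> \<U> \<Longrightarrow> A \<inter> B \<in> \<U>"
    and join_closed: "A \<in> \<U> \<Longrightarrow> B \<in> \<U> \<Longrightarrow> join A B \<in> \<U>"
    and join_upper: "A \<in> \<U> \<Longrightarrow> B \<in> \<U> \<Longrightarrow> A \<union> B \<subseteq> join A B"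
    and join_least: "A \<in> \<U> \<Longrightarrow> B \<in> \<U> \<Longrightarrow> C \<in> \<U> \<Longrightarrow> A \<subseteq> C \<Longrightarrow> B \<subseteq> C \<Longrightarrow> join A B \<subseteq> C"
    and dim_modular: "A \<in> \<U> \<Longrightarrow> B \<in> \<U> \<Longrightarrow> dim (join A B) + dim (A \<inter> B) = dim A + dim B"
    and dim_strict_mono: "A \<in> \<U> \<Longrightarrow> B \<in> \<U> \<Longrightarrow> A \<subset> B \<Longrightarrow> dim A < dim B"
begin

lemma dim_mono: "A \<in> \<U> \<Longrightarrow> B \<in> \<U> \<Longrightarrow> A \<subseteq> B \<Longrightarrow> dim A \<le> dim B"
  using dim_strict_mono by (cases "A = B") (auto intro: less_imp_le)

text \<open>The modular law, as needed for passing to the quotient by \<open>W\<close>.\<close>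

lemma dim_inter_join_le:
  assumes "U \<in> \<U>" "H \<in> \<U>" "W \<in> \<U>" "W \<subseteq> U"
  shows "dim (U \<inter> join H W) + dim (H \<inter> W) \<le> dim (U \<inter> H) + dim W"
proof -
  let ?Y = "U \<inter> join H W"
  have Y: "?Y \<in> \<U>" using assms by (simp add: inter_closed join_closed)
  have XH: "?Y \<inter> H = U \<inter> H" using join_upper[OF assms(2,3)] by blast
  have "join ?Y H \<subseteq> join H W"
    using join_upper[OF assms(2,3)] Y assms by (intro join_least) (auto simp: join_closed)
  then have "dim (join ?Y H) \<le> dim (join H W)"
    using Y assms by (intro dim_mono) (auto simp: join_closed)
  moreover have "dim (join ?Y H) + dim (?Y \<inter> H) = dim ?Y + dim H"
    using Y assms by (intro dim_modular)
  moreover have "dim (join H W) + dim (H \<inter> W) = dim H + dim W"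
    using assms by (intro dim_modular)
  ultimately show ?thesis using XH by simp
qed

text \<open>An interval [A, B] stands for the quotient B / A, so dimensions and values of
  \<open>G\<close> are taken relative to \<open>A\<close> and no quotient space has to be built. The
  last clause is the Brascamp-Lieb dimension condition, written with the kernels \<open>h i\<close>
  instead of the projections.\<close>

definition admissible :: "'i set \<Rightarrow> 'v set \<Rightarrow> 'v set \<Rightarrow> ('i \<Rightarrow> 'v set) \<Rightarrow> ('i \<Rightarrow> real) \<Rightarrow> bool" where
  "admissible I A B h c \<longleftrightarrow> A \<in> \<U> \<and> B \<in> \<U> \<and> A \<subseteq> B \<and>
     (\<forall>i\<in>I. h i \<in> \<U> \<and> A \<subseteq> h i \<and> h i \<subseteq> B \<and> 0 \<le> c i) \<and>
     (\<forall>U\<in>\<U>. A \<subseteq> U \<longrightarrow> U \<subseteq> B \<longrightarrow>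
        (\<Sum>i\<in>I. c i * (real (dim (U \<inter> h i)) - real (dim A))) \<le> real (dim U) - real (dim A))"

context
  fixes G :: "'v set \<Rightarrow> real"
  assumes G_mono: "\<And>A B. A \<in> \<U> \<Longrightarrow> B \<in> \<U> \<Longrightarrow> A \<subseteq> B \<Longrightarrow> G A \<le> G B"
    and G_super: "\<And>A B. A \<in> \<U> \<Longrightarrow> B \<in> \<U> \<Longrightarrow> G A + G B \<le> G (A \<inter> B) + G (join A B)"
begin

abbreviation gain :: "'i set \<Rightarrow> 'v set \<Rightarrow> ('i \<Rightarrow> 'v set) \<Rightarrow> ('i \<Rightarrow> real) \<Rightarrow> real" where
  "gain I A h c \<equiv> \<Sum>i\<in>I. c i * (G (h i) - G A)"

text \<open>Reduction along a tight \<open>U\<close>: \<open>h i \<inter> U\<close> and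
  \<open>join (h i) U\<close> are the traces of \<open>h i\<close> in U / A and B / U.
  Supermodularity of \<open>G\<close> bounds the original gain by the sum of the two new
  ones.\<close>

lemma gain_split:
  assumes adm: "admissible I A B h c" and U: "U \<in> \<U>" "A \<subseteq> U" "U \<subseteq> B"
    and tight: "(\<Sum>i\<in>I. c i * (real (dim (U \<inter> h i)) - real (dim A))) = real (dim U) - real (dim A)"
    and lower: "\<And>h c. admissible I A U h c \<Longrightarrow> gain I A h c \<le> G U - G A"
    and upper: "\<And>h c. admissible I U B h c \<Longrightarrow> gain I U h c \<le> G B - G U"
  shows "gain I A h c \<le> G B - G A"
proof -
  have hi: "h i \<in> \<U>" "A \<subseteq> h i" "h i \<subseteq> B" "0 \<le> c i" if "i \<in> I" for i
    using adm that by (auto simp: admissible_def)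
  have AB: "A \<in> \<U>" "B \<in> \<U>" using adm by (auto simp: admissible_def)
  have cond: "(\<Sum>i\<in>I. c i * (real (dim (Y \<inter> h i)) - real (dim A))) \<le> real (dim Y) - real (dim A)"
    if "Y \<in> \<U>" "A \<subseteq> Y" "Y \<subseteq> B" for Y
    using adm that by (auto simp: admissible_def)
  have "gain I A (\<lambda>i. h i \<inter> U) c \<le> G U - G A"
  proof (rule lower, unfold admissible_def, intro conjI ballI impI)
    fix Y assume Y: "Y \<in> \<U>" "A \<subseteq> Y" "Y \<subseteq> U"
    then have "Y \<inter> (h i \<inter> U) = Y \<inter> h i" for i by blast
    then show "(\<Sum>i\<in>I. c i * (real (dim (Y \<inter> (h i \<inter> U))) - real (dim A))) \<le> real (dim Y) - real (dim A)"
      using cond[of Y] Y U by simp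
  qed (use U AB hi in \<open>auto intro: inter_closed\<close>)
  moreover have "gain I U (\<lambda>i. join (h i) U) c \<le> G B - G U"
  proof (rule upper, unfold admissible_def, intro conjI ballI impI)
    fix Y assume Y: "Y \<in> \<U>" "U \<subseteq> Y" "Y \<subseteq> B"
    \<comment> \<open>Subtracting the tight equality at \<open>U\<close> from the condition at
      \<open>Y\<close> gives the condition in the quotient by \<open>U\<close>.\<close>
    have "(\<Sum>i\<in>I. c i * (real (dim (Y \<inter> join (h i) U)) - real (dim U)))
      \<le> (\<Sum>i\<in>I. c i * (real (dim (Y \<inter> h i)) - real (dim A))
            - c i * (real (dim (U \<inter> h i)) - real (dim A)))"
    proof (rule sum_mono)
      fix i assume i: "i \<in> I"
      have "dim (Y \<inter> join (h i) U) + dim (h i \<inter> U) \<le> dim (Y \<inter> h i) + dim U"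
        using Y U hi[OF i] by (intro dim_inter_join_le)
      then have "real (dim (Y \<inter> join (h i) U)) - real (dim U)
        \<le> (real (dim (Y \<inter> h i)) - real (dim A)) - (real (dim (U \<inter> h i)) - real (dim A))"
        by (simp add: Int_commute)
      from mult_left_mono[OF this hi(4)[OF i]]
      show "c i * (real (dim (Y \<inter> join (h i) U)) - real (dim U))
        \<le> c i * (real (dim (Y \<inter> h i)) - real (dim A)) - c i * (real (dim (U \<inter> h i)) - real (dim A))"
        by (simp add: right_diff_distrib)
    qed
    also have "\<dots> \<le> real (dim Y) - real (dim U)"
      using cond[of Y] Y order_trans[OF U(2) Y(2)] tight by (simp add: sum_subtractf)
    finally show "(\<Sum>i\<in>I. c i * (real (dim (Y \<inter> join (h i) U)) - real (dim U))) \<le> real (dim Y) - real (dim U)" .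
  next
    fix i assume i: "i \<in> I"
    show "join (h i) U \<in> \<U>" "join (h i) U \<subseteq> B" "0 \<le> c i" "U \<subseteq> join (h i) U"
      using hi[OF i] U AB join_closed join_least join_upper[of "h i" U] by auto
  qed (use U AB in auto)
  moreover have "gain I A h c \<le> gain I A (\<lambda>i. h i \<inter> U) c + gain I U (\<lambda>i. join (h i) U) c"
    unfolding sum.distrib[symmetric]
  proof (rule sum_mono)
    fix i assume i: "i \<in> I"
    have "G (h i) - G A \<le> (G (h i \<inter> U) - G A) + (G (join (h i) U) - G U)"
      using G_super[OF hi(1)[OF i] U(1)] by simp
    from mult_left_mono[OF this hi(4)[OF i]]
    show "c i * (G (h i) - G A) \<le> c i * (G (h i \<inter> U) - G A) + c i * (G (join (h i) U) - G U)"
      by (simp add: distrib_left)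
  qed
  ultimately show ?thesis by simp
qed

text \<open>Moving weight between two indices along the direction that keeps the constraint at the top
  element: a vertex of the polytope of admissible weights either has a proper tight element or a
  support of at most one index.\<close>

lemma admissible_shift:
  assumes fin: "finite I" and adm: "admissible I A B h c"
    and ij: "i \<in> I" "j \<in> I" "i \<noteq> j" "0 < c j" "h i \<noteq> A" "h j \<noteq> A"
    and slack: "\<And>U. U \<in> \<U> \<Longrightarrow> A \<subset> U \<Longrightarrow> U \<subset> B \<Longrightarrow>
      (\<Sum>i\<in>I. c i * (real (dim (U \<inter> h i)) - real (dim A))) < real (dim U) - real (dim A)"
    and slope: "(G (h j) - G A) / (real (dim (h j)) - real (dim A))
      \<le> (G (h i) - G A) / (real (dim (h i)) - real (dim A))"
  obtains c' where "admissible I A B h c'" "gain I A h c \<le> gain I A h c'"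
    "\<And>m. m \<in> I \<Longrightarrow> m \<noteq> i \<Longrightarrow> m \<noteq> j \<Longrightarrow> c' m = c m" "c' j = 0 \<or>
      (\<exists>U\<in>\<U>. A \<subset> U \<and> U \<subset> B \<and>
        (\<Sum>i\<in>I. c' i * (real (dim (U \<inter> h i)) - real (dim A))) = real (dim U) - real (dim A))"
proof -
  \<comment> \<open>\<open>a m\<close> and \<open>e U m\<close> are the dimensions of
    \<open>h m\<close> and \<open>U \<inter> h m\<close> over \<open>A\<close>,
    \<open>\<sigma> U\<close> is the slack of the constraint at \<open>U\<close>, and
    \<open>\<beta> U\<close> is the rate at which this slack shrinks when weight is added at
    \<open>i\<close> in units 1 / a i and removed at \<open>j\<close> in units 1 / a j.\<close>
  define a where "a m = real (dim (h m)) - real (dim A)" for m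
  define e where "e U m = real (dim (U \<inter> h m)) - real (dim A)" for U m
  define \<sigma> where "\<sigma> U = real (dim U) - real (dim A) - (\<Sum>m\<in>I. c m * e U m)" for U
  define \<beta> where "\<beta> U = e U i / a i - e U j / a j" for U
  have hi: "h m \<in> \<U>" "A \<subseteq> h m" "h m \<subseteq> B" "0 \<le> c m" if "m \<in> I" for m
    using adm that by (auto simp: admissible_def)
  have AB: "A \<in> \<U>" "B \<in> \<U>" "A \<subseteq> B" using adm by (auto simp: admissible_def)
  have a_pos: "a i > 0" "a j > 0"
    using dim_strict_mono[of A "h i"] dim_strict_mono[of A "h j"] hi[OF ij(1)] hi[OF ij(2)] ij AB
    by (auto simp: a_def)
  define Q where "Q = {U \<in> \<U>. A \<subset> U \<and> U \<subset> B \<and> \<beta> U > 0}"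
  \<comment> \<open>The step lengths at which the move has to stop: the weight of \<open>j\<close>
    reaches 0, or a proper \<open>U\<close> becomes tight.\<close>
  define T where "T = insert (c j * a j) ((\<lambda>U. \<sigma> U / \<beta> U) ` Q)"
  have finT: "finite T" "T \<noteq> {}" using finite_lattice by (auto simp: T_def Q_def)
  define t where "t = Min T"
  have t_le: "t \<le> x" if "x \<in> T" for x using that finT by (simp add: t_def)
  have t_in: "t \<in> T" using finT by (simp add: t_def)
  have \<sigma>_pos: "\<sigma> U > 0" if "U \<in> \<U>" "A \<subset> U" "U \<subset> B" for U
    using slack[OF that] by (simp add: \<sigma>_def e_def)
  have "\<sigma> U / \<beta> U > 0" if "U \<in> Q" for U
    using that \<sigma>_pos by (simp add: Q_def)
  then have t_pos: "t > 0"
    using t_in ij(4) a_pos(2) by (auto simp: T_def)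
  define c' where "c' = (\<lambda>m. if m = i then c i + t / a i else if m = j then c j - t / a j else c m)"
  have lin: "(\<Sum>m\<in>I. c' m * f m) = (\<Sum>m\<in>I. c m * f m) + t * (f i / a i - f j / a j)" for f
  proof -
    have "(\<Sum>m\<in>I. c' m * f m) = (\<Sum>m\<in>I. c m * f m + (if m = i then t / a i * f i else 0)
        - (if m = j then t / a j * f j else 0))"
      using ij by (intro sum.cong refl) (auto simp: c'_def algebra_simps)
    then show ?thesis using fin ij
      by (simp add: sum.distrib sum_subtractf algebra_simps)
  qed
  have con: "(\<Sum>m\<in>I. c' m * e U m) = real (dim U) - real (dim A) - (\<sigma> U - t * \<beta> U)" for U
    unfolding lin by (simp add: \<sigma>_def \<beta>_def)
  have \<sigma>_nonneg: "\<sigma> U \<ge> 0" if "U \<in> \<U>" "A \<subseteq> U" "U \<subseteq> B" for U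
    using adm that by (auto simp: admissible_def \<sigma>_def e_def)
  have "admissible I A B h c'"
    unfolding admissible_def
  proof (intro conjI ballI impI)
    fix m assume m: "m \<in> I"
    show "h m \<in> \<U>" "A \<subseteq> h m" "h m \<subseteq> B" using hi[OF m] by auto
    have "t \<le> c j * a j" by (intro t_le) (simp add: T_def)
    then have "t / a j \<le> c j" using a_pos by (simp add: divide_le_eq)
    then show "0 \<le> c' m" using hi[OF m] hi[OF ij(1)] t_pos a_pos by (auto simp: c'_def)
  next
    fix U assume U: "U \<in> \<U>" "A \<subseteq> U" "U \<subseteq> B"
    have "t * \<beta> U \<le> \<sigma> U"
    proof (cases "\<beta> U > 0")
      case True
      consider "U = A" | "U = B" | "A \<subset> U" "U \<subset> B" using U by blast
      then show ?thesis
      proof cases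
        case 1
        have "A \<inter> h i = A" "A \<inter> h j = A" using hi(2) ij(1,2) by blast+
        then have "\<beta> U = 0" using 1 by (simp add: \<beta>_def e_def)
        then show ?thesis using \<sigma>_nonneg[OF U] by simp
      next
        case 2
        have "B \<inter> h i = h i" "B \<inter> h j = h j" using hi(3) ij(1,2) by blast+
        then have "\<beta> U = 0" using 2 a_pos by (simp add: \<beta>_def e_def a_def)
        then show ?thesis using \<sigma>_nonneg[OF U] by simp
      next
        case 3
        then have "t \<le> \<sigma> U / \<beta> U" using U True by (intro t_le) (auto simp: T_def Q_def)
        then show ?thesis using True by (simp add: le_divide_eq)
      qed
    next
      case False
      then have "t * \<beta> U \<le> 0" using t_pos by (simp add: mult_nonneg_nonpos)
      then show ?thesis using \<sigma>_nonneg[OF U] by simp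
    qed
    then show "(\<Sum>m\<in>I. c' m * (real (dim (U \<inter> h m)) - real (dim A))) \<le> real (dim U) - real (dim A)"
      using con[of U] by (simp add: e_def)
  qed (use AB in auto)
  moreover have "gain I A h c \<le> gain I A h c'"
    using slope t_pos unfolding lin[of "\<lambda>m. G (h m) - G A"] a_def by simp
  moreover have "c' m = c m" if "m \<in> I" "m \<noteq> i" "m \<noteq> j" for m using that by (simp add: c'_def)
  moreover have "c' j = 0 \<or> (\<exists>U\<in>\<U>. A \<subset> U \<and> U \<subset> B \<and>
        (\<Sum>i\<in>I. c' i * (real (dim (U \<inter> h i)) - real (dim A))) = real (dim U) - real (dim A))"
  proof (cases "t = c j * a j")
    case True
    then show ?thesis using ij a_pos by (simp add: c'_def)
  next
    case False
    then obtain U where U: "U \<in> Q" "t = \<sigma> U / \<beta> U" using t_in by (auto simp: T_def)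
    then have "\<sigma> U - t * \<beta> U = 0" by (simp add: Q_def)
    then show ?thesis using con[of U] U(1) unfolding Q_def e_def by auto
  qed
  ultimately show ?thesis using that by blast
qed

text \<open>A proper tight element splits the problem into two shorter intervals; otherwise the weights can be
  moved towards a vertex of the polytope without decreasing the gain.\<close>

theorem brascamp_lieb:
  assumes fin: "finite I"
  shows "admissible I A B h c \<Longrightarrow> gain I A h c \<le> G B - G A"
proof (induction "dim B - dim A" arbitrary: A B h c rule: less_induct)
  case outer: less
  have AB: "A \<in> \<U>" "B \<in> \<U>" "A \<subseteq> B" using outer.prems by (auto simp: admissible_def)
  have tight_case: "gain I A h c \<le> G B - G A"
    if adm: "admissible I A B h c" and U: "U \<in> \<U>" "A \<subset> U" "U \<subset> B"
      and tight: "(\<Sum>i\<in>I. c i * (real (dim (U \<inter> h i)) - real (dim A))) = real (dim U) - real (dim A)"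
    for h c U
  proof (rule gain_split[OF adm _ _ _ tight])
    have "dim A < dim U" "dim U < dim B" using U AB dim_strict_mono by auto
    then have lt: "dim U - dim A < dim B - dim A" "dim B - dim U < dim B - dim A" by auto
    show "gain I A h c \<le> G U - G A" if "admissible I A U h c" for h c
      using outer.hyps[OF lt(1) that] .
    show "gain I U h c \<le> G B - G U" if "admissible I U B h c" for h c
      using outer.hyps[OF lt(2) that] .
  qed (use U in auto)
  \<comment> \<open>Inner induction on the support. Indices with h i = A are left out: they have
    zero gain and zero relative dimension, and without them the slopes below have nonzero
    denominators.\<close>
  define supp where "supp h c = {i \<in> I. 0 < c i \<and> h i \<noteq> A}" for h and c :: "_ \<Rightarrow> real"
  have "gain I A h c \<le> G B - G A" if "admissible I A B h c" for c
    using that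
  proof (induction "card (supp h c)" arbitrary: c rule: less_induct)
    case less
    have hi: "h i \<in> \<U>" "A \<subseteq> h i" "h i \<subseteq> B" "0 \<le> c i" if "i \<in> I" for i
      using less.prems that by (auto simp: admissible_def)
    have fin_supp: "finite (supp h c)" using fin by (simp add: supp_def)
    have gain_supp: "gain I A h c = gain (supp h c) A h c"
    proof (rule sum.mono_neutral_right[OF fin])
      show "\<forall>i\<in>I - supp h c. c i * (G (h i) - G A) = 0"
      proof
        fix i assume i: "i \<in> I - supp h c"
        then have "c i = 0 \<or> h i = A" using hi(4)[of i] by (auto simp: supp_def)
        then show "c i * (G (h i) - G A) = 0" by auto
      qed
    qed (auto simp: supp_def)
    show ?case
    proof (cases "\<exists>U\<in>\<U>. A \<subset> U \<and> U \<subset> B \<and>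
        (\<Sum>i\<in>I. c i * (real (dim (U \<inter> h i)) - real (dim A))) = real (dim U) - real (dim A)")
      case True
      then show ?thesis using tight_case less.prems by blast
    next
      case False
      have slack: "(\<Sum>i\<in>I. c i * (real (dim (U \<inter> h i)) - real (dim A))) < real (dim U) - real (dim A)"
        if "U \<in> \<U>" "A \<subset> U" "U \<subset> B" for U
      proof -
        have "(\<Sum>i\<in>I. c i * (real (dim (U \<inter> h i)) - real (dim A))) \<le> real (dim U) - real (dim A)"
          using less.prems that by (auto simp: admissible_def)
        moreover have "(\<Sum>i\<in>I. c i * (real (dim (U \<inter> h i)) - real (dim A))) \<noteq> real (dim U) - real (dim A)"
          using False that by blast
        ultimately show ?thesis by (rule order_le_neq_trans)
      qed
      consider "supp h c = {}" | i where "supp h c = {i}"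
        | i j where "i \<in> supp h c" "j \<in> supp h c" "i \<noteq> j" by blast
      then show ?thesis
      proof cases
        case 1
        then show ?thesis using G_mono AB gain_supp by simp
      next
        case (2 i)
        then have i: "i \<in> I" "0 < c i" "h i \<noteq> A" by (auto simp: supp_def)
        have dl: "dim A < dim (h i)" using dim_strict_mono[of A "h i"] hi[OF i(1)] i AB by auto
        \<comment> \<open>Testing admissibility at U = h i bounds the single weight by 1.\<close>
        have "c i * (real (dim (h i \<inter> h i)) - real (dim A))
          \<le> (\<Sum>m\<in>I. c m * (real (dim (h i \<inter> h m)) - real (dim A)))"
        proof (rule member_le_sum[OF i(1) _ fin])
          fix m assume "m \<in> I - {i}"
          then have "m \<in> I" by simp
          have "dim A \<le> dim (h i \<inter> h m)"
            using hi[OF \<open>m \<in> I\<close>] hi[OF i(1)] AB by (intro dim_mono) (auto intro: inter_closed)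
          then show "0 \<le> c m * (real (dim (h i \<inter> h m)) - real (dim A))"
            using hi(4)[OF \<open>m \<in> I\<close>] by simp
        qed
        also have "\<dots> \<le> real (dim (h i)) - real (dim A)"
          using less.prems hi[OF i(1)] by (auto simp: admissible_def)
        finally have "c i \<le> 1" using dl by simp
        moreover have "0 \<le> G (h i) - G A" using G_mono hi[OF i(1)] AB by simp
        ultimately have "c i * (G (h i) - G A) \<le> G (h i) - G A"
          using mult_right_mono[of "c i" 1] by simp
        also have "\<dots> \<le> G B - G A" using G_mono hi[OF i(1)] AB by simp
        finally show ?thesis using gain_supp 2 by simp
      next
        case (3 i j)
        \<comment> \<open>Gain per unit of relative dimension. Weight moves to the index where it is
          larger, so the total gain cannot fall.\<close>
        define \<phi> where "\<phi> m = (G (h m) - G A) / (real (dim (h m)) - real (dim A))" for m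
        have "\<exists>i j. i \<in> supp h c \<and> j \<in> supp h c \<and> i \<noteq> j \<and> \<phi> j \<le> \<phi> i"
        proof (cases "\<phi> j \<le> \<phi> i")
          case False
          then have "\<phi> i \<le> \<phi> j" by simp
          then show ?thesis using 3 by blast
        qed (use 3 in blast)
        then obtain i j where ij: "i \<in> supp h c" "j \<in> supp h c" "i \<noteq> j" "\<phi> j \<le> \<phi> i"
          by blast
        have ij': "i \<in> I" "j \<in> I" "0 < c i" "0 < c j" "h i \<noteq> A" "h j \<noteq> A"
          using ij by (auto simp: supp_def)
        obtain c' where c': "admissible I A B h c'" "gain I A h c \<le> gain I A h c'"
          "\<And>m. m \<in> I \<Longrightarrow> m \<noteq> i \<Longrightarrow> m \<noteq> j \<Longrightarrow> c' m = c m" "c' j = 0 \<or>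
            (\<exists>U\<in>\<U>. A \<subset> U \<and> U \<subset> B \<and>
            (\<Sum>i\<in>I. c' i * (real (dim (U \<inter> h i)) - real (dim A))) = real (dim U) - real (dim A))"
          by (rule admissible_shift[OF fin less.prems ij'(1,2) ij(3) ij'(4-6) slack
                ij(4)[unfolded \<phi>_def]])
            (assumption | rule that)+
        have "gain I A h c' \<le> G B - G A"
        proof (cases "c' j = 0")
          case True
          have "supp h c' \<subset> supp h c"
          proof
            show "supp h c' \<subseteq> supp h c"
            proof
              fix m assume m: "m \<in> supp h c'"
              then have "m \<noteq> j" using True by (auto simp: supp_def)
              then show "m \<in> supp h c" using m ij(1) c'(3)[of m]
                by (cases "m = i") (auto simp: supp_def)
            qed
            have "j \<notin> supp h c'" using True by (simp add: supp_def)
            then show "supp h c' \<noteq> supp h c" using ij(2) by blast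
          qed
          then have "card (supp h c') < card (supp h c)"
            by (rule psubset_card_mono[OF fin_supp])
          then show ?thesis using less.hyps c'(1) by blast
        next
          case False
          then show ?thesis using c'(1,4) tight_case by blast
        qed
        then show ?thesis using c'(2) by simp
      qed
    qed
  qed
  then show ?case using outer.prems by blast
qed

end

end

subsection \<open>Finite vector spaces\<close>

text \<open>\<open>M\<close> may be infinite, as the polynomial ring is; \<open>V\<close> marks the
  finite subspace inside which all counting takes place.\<close>

locale finite_vector_space = module R M + R?: field R
  for R :: "('a, 'm) ring_scheme" (structure) and M :: "('a, 'v, 'n) module_scheme" (structure) +
  fixes V :: "'v set"
  assumes finite_scalars: "finite (carrier R)"
    and submodule_V: "submodule V R M"
    and finite_V: "finite V"
begin

definition subspaces :: "'v set set" where
  "subspaces = {U. submodule U R M \<and> U \<subseteq> V}"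

abbreviation q :: nat where "q \<equiv> card (carrier R)"

lemma q_ge_2: "2 \<le> q"
proof -
  have "{\<zero>, \<one>} \<subseteq> carrier R" by simp
  then have "card {\<zero>, \<one>} \<le> q" using finite_scalars card_mono by blast
  then show ?thesis by simp
qed

lemma subspaceD:
  assumes "U \<in> subspaces"
  shows "U \<subseteq> V" "finite U" "U \<subseteq> carrier M" "\<zero>\<^bsub>M\<^esub> \<in> U"
    "x \<in> U \<Longrightarrow> y \<in> U \<Longrightarrow> x \<oplus>\<^bsub>M\<^esub> y \<in> U"
    "x \<in> U \<Longrightarrow> \<ominus>\<^bsub>M\<^esub> x \<in> U"
    "x \<in> U \<Longrightarrow> y \<in> U \<Longrightarrow> x \<ominus>\<^bsub>M\<^esub> y \<in> U"
    "a \<in> carrier R \<Longrightarrow> x \<in> U \<Longrightarrow> a \<odot>\<^bsub>M\<^esub> x \<in> U"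
proof -
  have U: "submodule U R M" "U \<subseteq> V" using assms by (auto simp: subspaces_def)
  note E = submoduleE[OF U(1)]
  show "U \<subseteq> V" "finite U" using U finite_V finite_subset by auto
  show sub: "U \<subseteq> carrier M" by (rule E(1))
  show "x \<oplus>\<^bsub>M\<^esub> y \<in> U" if "x \<in> U" "y \<in> U" for x y using E(5) that by auto
  show "\<ominus>\<^bsub>M\<^esub> x \<in> U" if "x \<in> U" for x using E(3) that by auto
  show "x \<ominus>\<^bsub>M\<^esub> y \<in> U" if "x \<in> U" "y \<in> U" for x y
    using E(3,5) that by (simp add: a_minus_def)
  show "a \<odot>\<^bsub>M\<^esub> x \<in> U" if "a \<in> carrier R" "x \<in> U" for a x using E(4) that by auto
  obtain x where "x \<in> U" using E(2) by blast
  then have "\<zero> \<odot>\<^bsub>M\<^esub> x \<in> U" using E(4) by simp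
  then show "\<zero>\<^bsub>M\<^esub> \<in> U" using \<open>x \<in> U\<close> sub by auto
qed

lemma subspaceI:
  assumes "U \<subseteq> V" "\<zero>\<^bsub>M\<^esub> \<in> U"
    and "\<And>x y. x \<in> U \<Longrightarrow> y \<in> U \<Longrightarrow> x \<oplus>\<^bsub>M\<^esub> y \<in> U"
    and "\<And>a x. a \<in> carrier R \<Longrightarrow> x \<in> U \<Longrightarrow> a \<odot>\<^bsub>M\<^esub> x \<in> U"
  shows "U \<in> subspaces"
proof -
  have sub: "U \<subseteq> carrier M" using assms(1) submoduleE(1)[OF submodule_V] by blast
  have "\<ominus>\<^bsub>M\<^esub> x \<in> U" if "x \<in> U" for x
  proof -
    have "(\<ominus> \<one>) \<odot>\<^bsub>M\<^esub> x \<in> U" using assms(4) that by simp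
    then show ?thesis using that sub by (auto simp: smult_l_minus)
  qed
  then have "submodule U R M" using sub assms by (intro submoduleI) auto
  then show ?thesis using assms(1) by (simp add: subspaces_def)
qed

lemma V_subspace: "V \<in> subspaces"
  using submodule_V by (simp add: subspaces_def)

lemma zero_subspace: "{\<zero>\<^bsub>M\<^esub>} \<in> subspaces"
  using subspaceD(4)[OF V_subspace] by (intro subspaceI) auto

lemma finite_subspaces: "finite subspaces"
  by (rule finite_subset[of _ "Pow V"]) (auto simp: subspaces_def finite_V)

lemma inter_subspace: "A \<in> subspaces \<Longrightarrow> B \<in> subspaces \<Longrightarrow> A \<inter> B \<in> subspaces"
  by (intro subspaceI) (auto dest: subspaceD)

lemma mem_sum: "z \<in> A <+>\<^bsub>M\<^esub> B \<longleftrightarrow> (\<exists>x\<in>A. \<exists>y\<in>B. z = x \<oplus>\<^bsub>M\<^esub> y)"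
  by (auto simp: set_add_def')

lemma sum_memI: "x \<in> A \<Longrightarrow> y \<in> B \<Longrightarrow> x \<oplus>\<^bsub>M\<^esub> y \<in> A <+>\<^bsub>M\<^esub> B"
  by (auto simp: mem_sum)

lemma sum_subspace:
  assumes "A \<in> subspaces" "B \<in> subspaces"
  shows "A <+>\<^bsub>M\<^esub> B \<in> subspaces"
proof (rule subspaceI)
  note A = subspaceD[OF assms(1)] and B = subspaceD[OF assms(2)]
  note VD = subspaceD[OF V_subspace]
  show "A <+>\<^bsub>M\<^esub> B \<subseteq> V"
    using A(1) B(1) VD(5) by (fastforce simp: mem_sum)
  have "\<zero>\<^bsub>M\<^esub> \<oplus>\<^bsub>M\<^esub> \<zero>\<^bsub>M\<^esub> \<in> A <+>\<^bsub>M\<^esub> B" using A(4) B(4) by (rule sum_memI)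
  then show "\<zero>\<^bsub>M\<^esub> \<in> A <+>\<^bsub>M\<^esub> B" by simp
next
  note A = subspaceD[OF assms(1)] and B = subspaceD[OF assms(2)]
  fix x y assume "x \<in> A <+>\<^bsub>M\<^esub> B" "y \<in> A <+>\<^bsub>M\<^esub> B"
  then obtain a b c d where *: "a \<in> A" "b \<in> B" "x = a \<oplus>\<^bsub>M\<^esub> b" "c \<in> A" "d \<in> B" "y = c \<oplus>\<^bsub>M\<^esub> d"
    by (auto simp: mem_sum)
  then have "a \<in> carrier M" "b \<in> carrier M" "c \<in> carrier M" "d \<in> carrier M"
    using A(3) B(3) by auto
  then have "x \<oplus>\<^bsub>M\<^esub> y = (a \<oplus>\<^bsub>M\<^esub> c) \<oplus>\<^bsub>M\<^esub> (b \<oplus>\<^bsub>M\<^esub> d)"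
    using * by (simp add: M.a_ac)
  then show "x \<oplus>\<^bsub>M\<^esub> y \<in> A <+>\<^bsub>M\<^esub> B" using A(5) B(5) * by (simp add: sum_memI)
next
  note A = subspaceD[OF assms(1)] and B = subspaceD[OF assms(2)]
  fix c x assume c: "c \<in> carrier R" and "x \<in> A <+>\<^bsub>M\<^esub> B"
  then obtain a b where *: "a \<in> A" "b \<in> B" "x = a \<oplus>\<^bsub>M\<^esub> b" by (auto simp: mem_sum)
  then have "c \<odot>\<^bsub>M\<^esub> x = c \<odot>\<^bsub>M\<^esub> a \<oplus>\<^bsub>M\<^esub> c \<odot>\<^bsub>M\<^esub> b"
    using A(3) B(3) c by (simp add: smult_r_distr subset_iff)
  then show "c \<odot>\<^bsub>M\<^esub> x \<in> A <+>\<^bsub>M\<^esub> B" using A(8) B(8) c * by (simp add: sum_memI)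
qed

lemma sum_upper:
  assumes "A \<in> subspaces" "B \<in> subspaces"
  shows "A \<union> B \<subseteq> A <+>\<^bsub>M\<^esub> B"
proof -
  note A = subspaceD[OF assms(1)] and B = subspaceD[OF assms(2)]
  have "x \<in> A <+>\<^bsub>M\<^esub> B" if "x \<in> A" for x
  proof -
    have "x = x \<oplus>\<^bsub>M\<^esub> \<zero>\<^bsub>M\<^esub>" using A(3) that by auto
    then show ?thesis using sum_memI[OF that B(4)] by simp
  qed
  moreover have "x \<in> A <+>\<^bsub>M\<^esub> B" if "x \<in> B" for x
  proof -
    have "x = \<zero>\<^bsub>M\<^esub> \<oplus>\<^bsub>M\<^esub> x" using B(3) that by auto
    then show ?thesis using sum_memI[OF A(4) that] by simp
  qed
  ultimately show ?thesis by blast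
qed

lemma sum_least: "C \<in> subspaces \<Longrightarrow> A \<subseteq> C \<Longrightarrow> B \<subseteq> C \<Longrightarrow> A <+>\<^bsub>M\<^esub> B \<subseteq> C"
  using subspaceD(5)[of C] by (fastforce simp: mem_sum)

text \<open>The fibres of addition from A x B onto A + B are translates of A \<inter> B. This is the
  modular law for dimensions, with cardinalities in place of bases.\<close>

lemma card_sum_inter:
  assumes "A \<in> subspaces" "B \<in> subspaces"
  shows "card (A <+>\<^bsub>M\<^esub> B) * card (A \<inter> B) = card A * card B"
proof -
  note A = subspaceD[OF assms(1)] and B = subspaceD[OF assms(2)]
  have "\<forall>z\<in>A <+>\<^bsub>M\<^esub> B. \<exists>p. fst p \<in> A \<and> snd p \<in> B \<and> z = fst p \<oplus>\<^bsub>M\<^esub> snd p"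
  proof
    fix z assume "z \<in> A <+>\<^bsub>M\<^esub> B"
    then obtain x y where "x \<in> A" "y \<in> B" "z = x \<oplus>\<^bsub>M\<^esub> y" by (auto simp: mem_sum)
    then show "\<exists>p. fst p \<in> A \<and> snd p \<in> B \<and> z = fst p \<oplus>\<^bsub>M\<^esub> snd p"
      by (intro exI[of _ "(x, y)"]) simp
  qed
  then obtain p where p: "\<And>z. z \<in> A <+>\<^bsub>M\<^esub> B \<Longrightarrow> fst (p z) \<in> A \<and> snd (p z) \<in> B \<and> z = fst (p z) \<oplus>\<^bsub>M\<^esub> snd (p z)"
    by metis
  \<comment> \<open>\<open>p z\<close> fixes one decomposition of z; all others arise by moving an
    element w of A \<inter> B from one summand to the other.\<close>
  define f where "f = (\<lambda>(z, w). (fst (p z) \<oplus>\<^bsub>M\<^esub> w, snd (p z) \<ominus>\<^bsub>M\<^esub> w))"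
  have cancel: "(a \<oplus>\<^bsub>M\<^esub> w) \<oplus>\<^bsub>M\<^esub> (b \<ominus>\<^bsub>M\<^esub> w) = a \<oplus>\<^bsub>M\<^esub> b"
    if "a \<in> carrier M" "b \<in> carrier M" "w \<in> carrier M" for a b w
    using that by (simp add: a_minus_def M.a_ac M.r_neg M.r_neg1 M.r_neg2)
  have inC: "x \<in> carrier M" if "x \<in> A \<or> x \<in> B" for x using that A(3) B(3) by auto
  have "bij_betw f ((A <+>\<^bsub>M\<^esub> B) \<times> (A \<inter> B)) (A \<times> B)"
    unfolding bij_betw_def
  proof (intro conjI subset_antisym)
    show "inj_on f ((A <+>\<^bsub>M\<^esub> B) \<times> (A \<inter> B))"
    proof (rule inj_onI, clarify)
      fix z w z' w'
      assume z: "z \<in> A <+>\<^bsub>M\<^esub> B" "z' \<in> A <+>\<^bsub>M\<^esub> B"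
        and w: "w \<in> A" "w \<in> B" "w' \<in> A" "w' \<in> B" and eq: "f (z, w) = f (z', w')"
      have "z = (fst (p z) \<oplus>\<^bsub>M\<^esub> w) \<oplus>\<^bsub>M\<^esub> (snd (p z) \<ominus>\<^bsub>M\<^esub> w)"
        using cancel p[OF z(1)] w inC by metis
      also have "\<dots> = (fst (p z') \<oplus>\<^bsub>M\<^esub> w') \<oplus>\<^bsub>M\<^esub> (snd (p z') \<ominus>\<^bsub>M\<^esub> w')"
        using eq by (simp add: f_def)
      also have "\<dots> = z'" using cancel p[OF z(2)] w inC by metis
      finally have zz: "z = z'" .
      moreover have "fst (p z) \<oplus>\<^bsub>M\<^esub> w = fst (p z) \<oplus>\<^bsub>M\<^esub> w'" using eq zz by (simp add: f_def)
      then have "w = w'" using p[OF z(1)] w inC by simp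
      ultimately show "z = z' \<and> w = w'" by simp
    qed
    show "f ` ((A <+>\<^bsub>M\<^esub> B) \<times> (A \<inter> B)) \<subseteq> A \<times> B"
      using p A(5) B(7) by (fastforce simp: f_def)
    show "A \<times> B \<subseteq> f ` ((A <+>\<^bsub>M\<^esub> B) \<times> (A \<inter> B))"
    proof clarify
      fix a b assume ab: "a \<in> A" "b \<in> B"
      define z where "z = a \<oplus>\<^bsub>M\<^esub> b"
      have z: "z \<in> A <+>\<^bsub>M\<^esub> B" using ab by (simp add: z_def sum_memI)
      define c d where "c = fst (p z)" and "d = snd (p z)"
      have cd: "c \<in> A" "d \<in> B" "a \<oplus>\<^bsub>M\<^esub> b = c \<oplus>\<^bsub>M\<^esub> d" using p[OF z] by (auto simp: c_def d_def z_def)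
      have car: "a \<in> carrier M" "b \<in> carrier M" "c \<in> carrier M" "d \<in> carrier M"
        using ab cd inC by auto
      have "a \<ominus>\<^bsub>M\<^esub> c = (a \<ominus>\<^bsub>M\<^esub> c) \<oplus>\<^bsub>M\<^esub> (b \<ominus>\<^bsub>M\<^esub> b)"
        using car by (simp add: a_minus_def M.r_neg)
      also have "\<dots> = (a \<oplus>\<^bsub>M\<^esub> b) \<ominus>\<^bsub>M\<^esub> (c \<oplus>\<^bsub>M\<^esub> b)"
        using car by (simp add: a_minus_def M.minus_add M.a_ac)
      also have "\<dots> = (c \<oplus>\<^bsub>M\<^esub> d) \<ominus>\<^bsub>M\<^esub> (c \<oplus>\<^bsub>M\<^esub> b)" using cd by simp
      also have "\<dots> = (d \<ominus>\<^bsub>M\<^esub> b) \<oplus>\<^bsub>M\<^esub> (c \<ominus>\<^bsub>M\<^esub> c)"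
        using car by (simp add: a_minus_def M.minus_add M.a_ac)
      also have "\<dots> = d \<ominus>\<^bsub>M\<^esub> b"
        using car by (simp add: a_minus_def M.r_neg)
      finally have eq: "a \<ominus>\<^bsub>M\<^esub> c = d \<ominus>\<^bsub>M\<^esub> b" .
      define w where "w = a \<ominus>\<^bsub>M\<^esub> c"
      have "w \<in> A \<inter> B" using A(7)[OF ab(1) cd(1)] B(7)[OF cd(2) ab(2)] eq by (simp add: w_def)
      moreover have "c \<oplus>\<^bsub>M\<^esub> w = a \<oplus>\<^bsub>M\<^esub> (c \<ominus>\<^bsub>M\<^esub> c)"
        using car by (simp add: w_def a_minus_def M.a_ac)
      then have "c \<oplus>\<^bsub>M\<^esub> w = a"
        using car by (simp add: a_minus_def M.r_neg)
      moreover have "d \<ominus>\<^bsub>M\<^esub> w = (d \<ominus>\<^bsub>M\<^esub> d) \<oplus>\<^bsub>M\<^esub> b"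
        unfolding w_def eq using car by (simp add: a_minus_def M.minus_add M.a_ac)
      then have "d \<ominus>\<^bsub>M\<^esub> w = b"
        using car by (simp add: a_minus_def M.r_neg)
      ultimately show "(a, b) \<in> f ` ((A <+>\<^bsub>M\<^esub> B) \<times> (A \<inter> B))"
        using z by (intro image_eqI[of _ _ "(z, w)"]) (auto simp: f_def c_def d_def)
    qed
  qed
  from bij_betw_same_card[OF this] show ?thesis by (simp add: card_cartesian_product)
qed

definition line :: "'v \<Rightarrow> 'v set" where
  "line x = (\<lambda>a. a \<odot>\<^bsub>M\<^esub> x) ` carrier R"

lemma line_subspace:
  assumes "x \<in> V"
  shows "line x \<in> subspaces"
proof (rule subspaceI)
  note VD = subspaceD[OF V_subspace]
  have x: "x \<in> carrier M" using assms VD(3) by blast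
  show "line x \<subseteq> V" using assms VD(8) by (auto simp: line_def)
  have "\<zero> \<odot>\<^bsub>M\<^esub> x \<in> line x" unfolding line_def by (intro imageI) simp
  then show "\<zero>\<^bsub>M\<^esub> \<in> line x" using x by simp
  show "y \<oplus>\<^bsub>M\<^esub> z \<in> line x" if yz: "y \<in> line x" "z \<in> line x" for y z
  proof -
    obtain a b where ab: "a \<in> carrier R" "y = a \<odot>\<^bsub>M\<^esub> x" "b \<in> carrier R" "z = b \<odot>\<^bsub>M\<^esub> x"
      using yz unfolding line_def by blast
    then have "y \<oplus>\<^bsub>M\<^esub> z = (a \<oplus> b) \<odot>\<^bsub>M\<^esub> x" using x by (simp add: smult_l_distr)
    then show ?thesis using ab unfolding line_def by blast
  qed
  show "a \<odot>\<^bsub>M\<^esub> y \<in> line x" if a: "a \<in> carrier R" and y: "y \<in> line x" for a y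
  proof -
    obtain b where b: "b \<in> carrier R" "y = b \<odot>\<^bsub>M\<^esub> x"
      using y unfolding line_def by blast
    then have "a \<odot>\<^bsub>M\<^esub> y = (a \<otimes> b) \<odot>\<^bsub>M\<^esub> x" using x a by (simp add: smult_assoc1)
    then show ?thesis using a b unfolding line_def by blast
  qed
qed

lemma mem_line: "x \<in> V \<Longrightarrow> x \<in> line x"
  using subspaceD(3)[OF V_subspace] unfolding line_def
  by (intro image_eqI[of _ _ \<one>]) auto

lemma smult_mem_cancel:
  assumes U: "U \<in> subspaces" and x: "x \<in> V" and a: "a \<in> carrier R" "a \<noteq> \<zero>" and "a \<odot>\<^bsub>M\<^esub> x \<in> U"
  shows "x \<in> U"
proof -
  have xc: "x \<in> carrier M" using x subspaceD(3)[OF V_subspace] by blast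
  have ia: "inv a \<in> carrier R" "inv a \<otimes> a = \<one>" using a field_Units by auto
  have "inv a \<odot>\<^bsub>M\<^esub> (a \<odot>\<^bsub>M\<^esub> x) \<in> U" using subspaceD(8)[OF U ia(1) assms(5)] .
  then show ?thesis using ia a xc by (simp add: smult_assoc1[symmetric])
qed

lemma card_sum_line:
  assumes U: "U \<in> subspaces" and x: "x \<in> V" "x \<notin> U"
  shows "card (U <+>\<^bsub>M\<^esub> line x) = q * card U"
proof -
  note VD = subspaceD[OF V_subspace]
  have xc: "x \<in> carrier M" using x VD(3) by blast
  have L: "line x \<in> subspaces" using line_subspace[OF x(1)] .
  have "inj_on (\<lambda>a. a \<odot>\<^bsub>M\<^esub> x) (carrier R)"
  proof (rule inj_onI)
    fix a b assume ab: "a \<in> carrier R" "b \<in> carrier R" "a \<odot>\<^bsub>M\<^esub> x = b \<odot>\<^bsub>M\<^esub> x"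
    have "(a \<ominus> b) \<odot>\<^bsub>M\<^esub> x = a \<odot>\<^bsub>M\<^esub> x \<ominus>\<^bsub>M\<^esub> b \<odot>\<^bsub>M\<^esub> x"
      using ab(1,2) xc by (simp add: a_minus_def smult_l_distr smult_l_minus)
    also have "\<dots> = \<zero>\<^bsub>M\<^esub>" using ab xc by (simp add: a_minus_def M.r_neg)
    finally have "(a \<ominus> b) \<odot>\<^bsub>M\<^esub> x \<in> U" using subspaceD(4)[OF U] by simp
    then have "a \<ominus> b = \<zero>" using smult_mem_cancel[OF U x(1)] ab x(2) by blast
    then show "a = b" using ab by simp
  qed
  then have cl: "card (line x) = q" unfolding line_def by (rule card_image)
  have "U \<inter> line x = {\<zero>\<^bsub>M\<^esub>}"
  proof -
    have "y = \<zero>\<^bsub>M\<^esub>" if yU: "y \<in> U" and yL: "y \<in> line x" for y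
    proof -
      obtain a where a: "a \<in> carrier R" "y = a \<odot>\<^bsub>M\<^esub> x" using yL unfolding line_def by blast
      then have "a = \<zero>" using smult_mem_cancel[OF U x(1) a(1)] yU x(2) by blast
      then show ?thesis using a xc by simp
    qed
    then show ?thesis using subspaceD(4)[OF U] subspaceD(4)[OF L] by blast
  qed
  then show ?thesis using card_sum_inter[OF U L] cl by (simp add: mult.commute)
qed

text \<open>Adjoining a vector outside \<open>U\<close> multiplies the cardinality by
  \<open>q\<close>. Taking the zero space for \<open>U\<close> shows that every subspace has a power
  of \<open>q\<close> as its cardinality, on which \<open>vdim\<close> relies.\<close>

lemma card_subspace_quotient:
  assumes "U \<in> subspaces" "W \<in> subspaces" "U \<subseteq> W"
  shows "\<exists>d. card W = q ^ d * card U"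
  using assms
proof (induction "card W - card U" arbitrary: U rule: less_induct)
  case less
  show ?case
  proof (cases "U = W")
    case True
    then show ?thesis by (intro exI[of _ 0]) simp
  next
    case False
    then obtain x where x: "x \<in> W" "x \<notin> U" using less.prems by blast
    have xV: "x \<in> V" using x subspaceD(1)[OF less.prems(2)] by blast
    let ?U = "U <+>\<^bsub>M\<^esub> line x"
    have L: "line x \<in> subspaces" using line_subspace[OF xV] .
    have U': "?U \<in> subspaces" using sum_subspace[OF less.prems(1) L] .
    have "line x \<subseteq> W" unfolding line_def using subspaceD(8)[OF less.prems(2)] x by blast
    then have sub: "?U \<subseteq> W" using less.prems by (intro sum_least) auto
    have "x \<in> ?U" using mem_line[OF xV] sum_upper[OF less.prems(1) L] by blast
    then have "U \<subset> ?U" using sum_upper[OF less.prems(1) L] x by blast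
    then have "card U < card ?U" using subspaceD(2)[OF U'] psubset_card_mono by blast
    moreover have "card ?U \<le> card W" using sub subspaceD(2)[OF less.prems(2)] card_mono by blast
    ultimately have "card W - card ?U < card W - card U" by simp
    from less.hyps[OF this U' less.prems(2) sub]
    obtain d where "card W = q ^ d * card ?U" by blast
    then have "card W = q ^ Suc d * card U" using card_sum_line[OF less.prems(1) xV x(2)] by simp
    then show ?thesis by blast
  qed
qed

text \<open>Meaningful only if the cardinality is a power of \<open>q\<close>, as it is for subspaces.\<close>

definition vdim :: "'v set \<Rightarrow> nat" where
  "vdim U = (SOME d. card U = q ^ d)"

lemma card_subspace:
  assumes "U \<in> subspaces"
  shows "card U = q ^ vdim U"
proof -
  have "{\<zero>\<^bsub>M\<^esub>} \<subseteq> U" using subspaceD(4)[OF assms] by simp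
  from card_subspace_quotient[OF zero_subspace assms this]
  have "\<exists>d. card U = q ^ d" by simp
  then show ?thesis unfolding vdim_def by (rule someI_ex)
qed

lemma vdim_eqI: "U \<in> subspaces \<Longrightarrow> card U = q ^ d \<Longrightarrow> vdim U = d"
  using card_subspace q_ge_2 by (simp add: power_inject_exp)

lemma vdim_zero: "vdim {\<zero>\<^bsub>M\<^esub>} = 0"
  by (rule vdim_eqI[OF zero_subspace]) simp

lemma vdim_sum_line:
  assumes "U \<in> subspaces" "x \<in> V" "x \<notin> U"
  shows "vdim (U <+>\<^bsub>M\<^esub> line x) = Suc (vdim U)"
  using card_sum_line[OF assms] card_subspace[OF assms(1)]
  by (intro vdim_eqI sum_subspace line_subspace assms) simp

sublocale dimension_lattice subspaces "set_add M" vdim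
proof
  show "finite subspaces" by (rule finite_subspaces)
  fix A B assume AB: "A \<in> subspaces" "B \<in> subspaces"
  show "A \<inter> B \<in> subspaces" "A <+>\<^bsub>M\<^esub> B \<in> subspaces" "A \<union> B \<subseteq> A <+>\<^bsub>M\<^esub> B"
    using AB inter_subspace sum_subspace sum_upper by auto
  show "vdim (A <+>\<^bsub>M\<^esub> B) + vdim (A \<inter> B) = vdim A + vdim B"
  proof -
    have "q ^ (vdim (A <+>\<^bsub>M\<^esub> B) + vdim (A \<inter> B)) = q ^ (vdim A + vdim B)"
      using card_sum_inter[OF AB] AB
      by (simp add: power_add card_subspace inter_subspace sum_subspace)
    then show ?thesis using q_ge_2 by (simp add: power_inject_exp)
  qed
  show "vdim A < vdim B" if "A \<subset> B"
  proof -
    have "card A < card B" using that subspaceD(2)[OF AB(2)] psubset_card_mono by blast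
    then have "q ^ vdim A < q ^ vdim B" using AB by (simp add: card_subspace)
    then show ?thesis using q_ge_2 by (simp add: power_strict_increasing_iff)
  qed
next
  fix A B C assume "C \<in> subspaces" "A \<subseteq> C" "B \<subseteq> C"
  then show "A <+>\<^bsub>M\<^esub> B \<subseteq> C" by (rule sum_least)
qed

text \<open>A linear functional on \<open>W\<close> vanishing on \<open>U\<close> is determined by its values on \<open>T\<close>, which bounds the
  number of such functionals without introducing bases.\<close>

lemma spanning_complement:
  assumes "U \<in> subspaces" "W \<in> subspaces" "U \<subseteq> W"
  obtains T where "T \<subseteq> W" "card T + vdim U \<le> vdim W"
    "\<And>Z. Z \<in> subspaces \<Longrightarrow> U \<subseteq> Z \<Longrightarrow> T \<subseteq> Z \<Longrightarrow> W \<subseteq> Z"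
proof -
  have "\<exists>T\<subseteq>W. card T + vdim U \<le> vdim W \<and> (\<forall>Z\<in>subspaces. U \<subseteq> Z \<longrightarrow> T \<subseteq> Z \<longrightarrow> W \<subseteq> Z)"
    using assms
  proof (induction "vdim W - vdim U" arbitrary: U rule: less_induct)
    case less
    show ?case
    proof (cases "U = W")
      case True
      then show ?thesis by (intro exI[of _ "{}"]) simp
    next
      case False
      then obtain x where x: "x \<in> W" "x \<notin> U" using less.prems by blast
      have xV: "x \<in> V" using x subspaceD(1)[OF less.prems(2)] by blast
      let ?U = "U <+>\<^bsub>M\<^esub> line x"
      have L: "line x \<in> subspaces" using line_subspace[OF xV] .
      have U': "?U \<in> subspaces" using sum_subspace[OF less.prems(1) L] .
      have "line x \<subseteq> W" unfolding line_def using subspaceD(8)[OF less.prems(2)] x by blast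
      then have sub: "?U \<subseteq> W" using less.prems by (intro sum_least) auto
      have dU: "vdim ?U = Suc (vdim U)" using vdim_sum_line[OF less.prems(1) xV x(2)] .
      have "vdim ?U \<le> vdim W" using dim_mono[OF U' less.prems(2) sub] .
      then have "vdim W - vdim ?U < vdim W - vdim U" using dU by simp
      from less.hyps[OF this U' less.prems(2) sub]
      obtain T where T: "T \<subseteq> W" "card T + vdim ?U \<le> vdim W"
        "\<forall>Z\<in>subspaces. ?U \<subseteq> Z \<longrightarrow> T \<subseteq> Z \<longrightarrow> W \<subseteq> Z" by blast
      show ?thesis
      proof (intro exI[of _ "insert x T"] conjI ballI impI)
        show "insert x T \<subseteq> W" using T x by blast
        show "card (insert x T) + vdim U \<le> vdim W"
          using T(2) dU card_insert_le_m1[of "Suc (card T)" T x] by simp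
        fix Z assume Z: "Z \<in> subspaces" "U \<subseteq> Z" "insert x T \<subseteq> Z"
        have "line x \<subseteq> Z" unfolding line_def using subspaceD(8)[OF Z(1)] Z(3) by blast
        then have "?U \<subseteq> Z" by (rule sum_least[OF Z(1,2)])
        moreover have "T \<subseteq> Z" using Z(3) by simp
        ultimately show "W \<subseteq> Z" using T(3) Z(1) by simp
      qed
    qed
  qed
  then obtain T where "T \<subseteq> W" "card T + vdim U \<le> vdim W"
    "\<forall>Z\<in>subspaces. U \<subseteq> Z \<longrightarrow> T \<subseteq> Z \<longrightarrow> W \<subseteq> Z" by auto
  then show ?thesis by (intro that[of T]) simp_all
qed

end

subsection \<open>List recovery from the subspace design property\<close>

text \<open>\<open>proj i\<close> need not be linear and its values carry no structure: it enters
  only through its fibres on \<open>V\<close>, which are cosets of \<open>H i\<close>.\<close>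

locale subspace_design = finite_vector_space R M V
  for R :: "('a, 'm) ring_scheme" (structure) and M :: "('a, 'v, 'n) module_scheme" (structure)
    and V :: "'v set" +
  fixes n :: nat and H :: "nat \<Rightarrow> 'v set" and proj :: "nat \<Rightarrow> 'v \<Rightarrow> 'b"
    and D :: nat and \<tau> :: real
  assumes H_subspace: "i < n \<Longrightarrow> H i \<in> subspaces"
    and proj_eq_iff: "i < n \<Longrightarrow> x \<in> V \<Longrightarrow> y \<in> V \<Longrightarrow> proj i x = proj i y \<longleftrightarrow> x \<ominus>\<^bsub>M\<^esub> y \<in> H i"
    and design: "U \<in> subspaces \<Longrightarrow> vdim U \<le> D \<Longrightarrow>
      (\<Sum>i<n. real (vdim (U \<inter> H i))) \<le> \<tau> * real n * real (vdim U)"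
    and n_pos: "0 < n" and \<tau>_pos: "0 < \<tau>"
begin

lemma diff_zero_eq:
  "x \<in> carrier M \<Longrightarrow> y \<in> carrier M \<Longrightarrow> x \<ominus>\<^bsub>M\<^esub> y = \<zero>\<^bsub>M\<^esub> \<Longrightarrow> x = y"
  using M.minus_equality[of x "\<ominus>\<^bsub>M\<^esub> y"] by (simp add: a_minus_def)

lemma diff_minus_diff:
  "x \<in> carrier M \<Longrightarrow> y \<in> carrier M \<Longrightarrow> z \<in> carrier M \<Longrightarrow>
    (x \<ominus>\<^bsub>M\<^esub> z) \<ominus>\<^bsub>M\<^esub> (y \<ominus>\<^bsub>M\<^esub> z) = x \<ominus>\<^bsub>M\<^esub> y"
proof -
  assume car: "x \<in> carrier M" "y \<in> carrier M" "z \<in> carrier M"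
  have "(x \<ominus>\<^bsub>M\<^esub> z) \<ominus>\<^bsub>M\<^esub> (y \<ominus>\<^bsub>M\<^esub> z) = (x \<ominus>\<^bsub>M\<^esub> y) \<oplus>\<^bsub>M\<^esub> (z \<ominus>\<^bsub>M\<^esub> z)"
    using car by (simp add: a_minus_def M.minus_add M.a_ac)
  then show ?thesis using car by (simp add: a_minus_def M.r_neg)
qed

lemma diff_plus_diff:
  "x \<in> carrier M \<Longrightarrow> y \<in> carrier M \<Longrightarrow> z \<in> carrier M \<Longrightarrow>
    (x \<ominus>\<^bsub>M\<^esub> z) \<oplus>\<^bsub>M\<^esub> (z \<ominus>\<^bsub>M\<^esub> y) = x \<ominus>\<^bsub>M\<^esub> y"
proof -
  assume car: "x \<in> carrier M" "y \<in> carrier M" "z \<in> carrier M"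
  have "(x \<ominus>\<^bsub>M\<^esub> z) \<oplus>\<^bsub>M\<^esub> (z \<ominus>\<^bsub>M\<^esub> y) = (x \<ominus>\<^bsub>M\<^esub> y) \<oplus>\<^bsub>M\<^esub> (z \<ominus>\<^bsub>M\<^esub> z)"
    using car by (simp add: a_minus_def M.a_ac)
  then show ?thesis using car by (simp add: a_minus_def M.r_neg)
qed

lemma minus_diff:
  "x \<in> carrier M \<Longrightarrow> y \<in> carrier M \<Longrightarrow> \<ominus>\<^bsub>M\<^esub> (x \<ominus>\<^bsub>M\<^esub> y) = y \<ominus>\<^bsub>M\<^esub> x"
  by (simp add: a_minus_def M.minus_add M.a_ac)

definition affine_rel :: "'v set \<Rightarrow> 'v set \<Rightarrow> ('v \<times> 'v) set" where
  "affine_rel S U = {(x, y) \<in> S \<times> S. x \<ominus>\<^bsub>M\<^esub> y \<in> U}"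

lemma equiv_affine_rel:
  assumes U: "U \<in> subspaces" and S: "S \<subseteq> V"
  shows "equiv S (affine_rel S U)"
proof (rule equivI)
  have car: "x \<in> carrier M" if "x \<in> S" for x using that S subspaceD(3)[OF V_subspace] by blast
  show "affine_rel S U \<subseteq> S \<times> S" by (auto simp: affine_rel_def)
  show "refl_on S (affine_rel S U)"
    using car subspaceD(4)[OF U] by (auto simp: affine_rel_def a_minus_def M.r_neg intro!: refl_onI)
  show "sym (affine_rel S U)"
  proof (rule symI)
    fix x y assume "(x, y) \<in> affine_rel S U"
    then show "(y, x) \<in> affine_rel S U"
      using subspaceD(6)[OF U, of "x \<ominus>\<^bsub>M\<^esub> y"] car by (auto simp: affine_rel_def minus_diff)
  qed
  show "trans (affine_rel S U)"
  proof (rule transI)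
    fix x y z assume xyz: "(x, y) \<in> affine_rel S U" "(y, z) \<in> affine_rel S U"
    then have "(x \<ominus>\<^bsub>M\<^esub> y) \<oplus>\<^bsub>M\<^esub> (y \<ominus>\<^bsub>M\<^esub> z) \<in> U"
      using subspaceD(5)[OF U] by (auto simp: affine_rel_def)
    then show "(x, z) \<in> affine_rel S U"
      using xyz car by (auto simp: affine_rel_def diff_plus_diff)
  qed
qed

text \<open>This is \<open>brascamp_lieb\<close> on the interval from 0 to \<open>U\<close> with
  uniform weights 1 / (\<tau> n), for which admissibility is the design property. \<open>G\<close>
  is 0 at the zero space, whose classes on \<open>S\<close> are singletons, and |S| ln |S| at
  \<open>U\<close>, whose only class is \<open>S\<close>.\<close>

lemma entropy_design:
  assumes S: "S \<subseteq> V" and U: "U \<in> subspaces" "vdim U \<le> D"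
    and diff: "\<And>x y. x \<in> S \<Longrightarrow> y \<in> S \<Longrightarrow> x \<ominus>\<^bsub>M\<^esub> y \<in> U"
  shows "(\<Sum>i<n. \<Sum>x\<in>S. ln (real (card {y \<in> S. proj i y = proj i x})))
    \<le> \<tau> * real n * (real (card S) * ln (real (card S)))"
proof -
  have finS: "finite S" using S finite_V finite_subset by blast
  have car: "x \<in> carrier M" if "x \<in> S" for x using that S subspaceD(3)[OF V_subspace] by blast
  define G where "G W = class_entropy S (affine_rel S W)" for W
  note eq = equiv_affine_rel[OF _ S]
  have G_mono: "G A \<le> G B" if "A \<in> subspaces" "B \<in> subspaces" "A \<subseteq> B" for A B
    unfolding G_def using that
    by (intro class_entropy_mono finS eq) (auto simp: affine_rel_def)
  have G_super: "G A + G B \<le> G (A \<inter> B) + G (A <+>\<^bsub>M\<^esub> B)" if AB: "A \<in> subspaces" "B \<in> subspaces" for A B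
  proof -
    have "affine_rel S (A \<inter> B) = affine_rel S A \<inter> affine_rel S B" by (auto simp: affine_rel_def)
    then show ?thesis
      unfolding G_def using sum_upper[OF AB] class_entropy_supermodular[OF finS eq[OF AB(1)]
          eq[OF AB(2)] eq[OF sum_subspace[OF AB]]] by (simp add: affine_rel_def subset_iff)
  qed
  have zero_sub: "{\<zero>\<^bsub>M\<^esub>} \<subseteq> W" if "W \<in> subspaces" for W using subspaceD(4)[OF that] by simp
  have UH: "U \<inter> H i \<in> subspaces" if "i < n" for i
    using U(1) H_subspace[OF that] by (rule inter_subspace)
  define c where "c = (\<lambda>i::nat. 1 / (\<tau> * real n))"
  have tn: "0 < \<tau> * real n" using n_pos \<tau>_pos by simp
  have "admissible {..<n} {\<zero>\<^bsub>M\<^esub>} U (\<lambda>i. U \<inter> H i) c"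
    unfolding admissible_def
  proof (intro conjI ballI impI)
    fix W assume W: "W \<in> subspaces" "W \<subseteq> U"
    then have "vdim W \<le> D" using dim_mono[OF W(1) U(1) W(2)] U(2) by simp
    from design[OF W(1) this]
    have "(\<Sum>i<n. real (vdim (W \<inter> H i))) / (\<tau> * real n) \<le> real (vdim W)"
      using tn by (simp add: divide_le_eq mult.commute)
    moreover have "W \<inter> (U \<inter> H i) = W \<inter> H i" for i using W by blast
    ultimately show "(\<Sum>i<n. c i * (real (vdim (W \<inter> (U \<inter> H i))) - real (vdim {\<zero>\<^bsub>M\<^esub>})))
      \<le> real (vdim W) - real (vdim {\<zero>\<^bsub>M\<^esub>})"
      by (simp add: c_def vdim_zero sum_divide_distrib)
  qed (use U zero_sub UH H_subspace zero_subspace tn in \<open>auto simp: c_def\<close>)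
  then have "(\<Sum>i<n. c i * (G (U \<inter> H i) - G {\<zero>\<^bsub>M\<^esub>})) \<le> G U - G {\<zero>\<^bsub>M\<^esub>}"
    by (rule brascamp_lieb[where G = G, rotated 3]) (auto intro: G_mono G_super)
  then have "(\<Sum>i<n. G (U \<inter> H i) - G {\<zero>\<^bsub>M\<^esub>}) / (\<tau> * real n) \<le> G U - G {\<zero>\<^bsub>M\<^esub>}"
    by (simp add: c_def sum_divide_distrib)
  moreover have "G {\<zero>\<^bsub>M\<^esub>} = 0"
  proof -
    have "affine_rel S {\<zero>\<^bsub>M\<^esub>} `` {x} = {x}" if "x \<in> S" for x
      using that car by (auto simp: affine_rel_def a_minus_def M.r_neg dest: diff_zero_eq[unfolded a_minus_def, rotated 2])
    then show ?thesis by (simp add: G_def class_entropy_def)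
  qed
  moreover have "G U = real (card S) * ln (real (card S))"
  proof -
    have "affine_rel S U `` {x} = S" if "x \<in> S" for x
      using that diff by (auto simp: affine_rel_def)
    then show ?thesis by (simp add: G_def class_entropy_def)
  qed
  moreover have "G (U \<inter> H i) = (\<Sum>x\<in>S. ln (real (card {y \<in> S. proj i y = proj i x})))" if i: "i < n" for i
  proof -
    have "affine_rel S (U \<inter> H i) `` {x} = {y \<in> S. proj i y = proj i x}" if x: "x \<in> S" for x
    proof -
      have "x \<ominus>\<^bsub>M\<^esub> y \<in> H i \<longleftrightarrow> proj i y = proj i x" if "y \<in> S" for y
      proof -
        have "x \<in> V" "y \<in> V" using x that S by auto
        then show ?thesis using proj_eq_iff[OF i, of x y] by metis
      qed
      then show ?thesis using x diff by (auto simp: affine_rel_def)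
    qed
    then show ?thesis by (simp add: G_def class_entropy_def)
  qed
  ultimately show ?thesis using tn by (simp add: divide_le_eq mult.commute)
qed

section \<open>Bounds for lists with agreement at least \<rho>\<close>

context
  fixes S :: "'v set" and L :: "nat \<Rightarrow> 'b set" and \<rho> :: real and l :: nat
  assumes S: "S \<subseteq> V" and S_ne: "S \<noteq> {}"
    and L: "\<And>i. i < n \<Longrightarrow> finite (L i) \<and> card (L i) = l"
    and agree: "\<And>x. x \<in> S \<Longrightarrow> \<rho> * real n \<le> real (card {i \<in> {..<n}. proj i x \<in> L i})"
    and gap: "\<tau> < \<rho>"
begin

lemma list_finite: "finite S"
  using S finite_V finite_subset by blast

lemma list_carrier: "x \<in> S \<Longrightarrow> x \<in> carrier M"
  using S subspaceD(3)[OF V_subspace] by blast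

lemma agreement_double_count:
  assumes "T \<subseteq> S"
  shows "\<rho> * real n * real (card T) \<le> (\<Sum>i<n. real (card {x \<in> T. proj i x \<in> L i}))"
proof -
  have finT: "finite T" using assms list_finite finite_subset by blast
  have "\<rho> * real n * real (card T) = (\<Sum>x\<in>T. \<rho> * real n)" by simp
  also have "\<dots> \<le> (\<Sum>x\<in>T. real (card {i \<in> {..<n}. proj i x \<in> L i}))"
    using assms agree by (intro sum_mono) auto
  also have "\<dots> = (\<Sum>x\<in>T. \<Sum>i<n. if proj i x \<in> L i then 1 else 0)"
    by (intro sum.cong refl) (simp add: sum.If_cases Int_def)
  also have "\<dots> = (\<Sum>i<n. \<Sum>x\<in>T. if proj i x \<in> L i then 1 else 0)" by (rule sum.swap)
  also have "\<dots> = (\<Sum>i<n. real (card {x \<in> T. proj i x \<in> L i}))"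
    using finT by (intro sum.cong refl) (simp add: sum.If_cases Int_def)
  finally show ?thesis .
qed

text \<open>Affinely independent list elements collide in coordinate \<open>i\<close> only along \<open>H i\<close>. Hence
  many of them would contradict the design property, and the list has small affine dimension.\<close>

lemma list_in_small_subspace:
  assumes D: "real l < real D * (\<rho> - \<tau>) + \<rho>"
  obtains U where "U \<in> subspaces" "vdim U < D" "\<And>x y. x \<in> S \<Longrightarrow> y \<in> S \<Longrightarrow> x \<ominus>\<^bsub>M\<^esub> y \<in> U"
proof -
  obtain x0 where x0: "x0 \<in> S" using S_ne by blast
  \<comment> \<open>\<open>U\<close> plays the role of the span of the differences with
    \<open>x0\<close>. The last clause controls collisions: in coordinate i at most dim (U \<inter>
    H i) symbols are lost.\<close>
  define indep where "indep T U \<longleftrightarrow> T \<subseteq> S \<and> x0 \<in> T \<and> U \<in> subspaces \<and> card T = Suc (vdim U) \<and>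
    (\<forall>x\<in>T. x \<ominus>\<^bsub>M\<^esub> x0 \<in> U) \<and> (\<forall>i<n. card T \<le> card (proj i ` T) + vdim (U \<inter> H i))" for T U
  have extend: "\<exists>T' U'. indep T' U' \<and> vdim U' = Suc (vdim U)"
    if TU: "indep T U" and y: "y \<in> S" "y \<ominus>\<^bsub>M\<^esub> x0 \<notin> U" for T U y
  proof -
    have T: "T \<subseteq> S" "x0 \<in> T" "U \<in> subspaces" "card T = Suc (vdim U)"
      "\<And>x. x \<in> T \<Longrightarrow> x \<ominus>\<^bsub>M\<^esub> x0 \<in> U" "\<And>i. i < n \<Longrightarrow> card T \<le> card (proj i ` T) + vdim (U \<inter> H i)"
      using TU by (auto simp: indep_def)
    have finT: "finite T" using T(1) list_finite finite_subset by blast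
    have yT: "y \<notin> T" using y T(5) by blast
    have dV: "y \<ominus>\<^bsub>M\<^esub> x0 \<in> V" using y(1) x0 S subspaceD(7)[OF V_subspace] by blast
    define U' where "U' = U <+>\<^bsub>M\<^esub> line (y \<ominus>\<^bsub>M\<^esub> x0)"
    have U': "U' \<in> subspaces" "vdim U' = Suc (vdim U)" "U \<subseteq> U'" "y \<ominus>\<^bsub>M\<^esub> x0 \<in> U'"
      using sum_subspace[OF T(3) line_subspace[OF dV]] vdim_sum_line[OF T(3) dV y(2)]
        sum_upper[OF T(3) line_subspace[OF dV]] mem_line[OF dV] by (auto simp: U'_def)
    have "card (insert y T) \<le> card (proj i ` insert y T) + vdim (U' \<inter> H i)" if i: "i < n" for i
    proof (cases "proj i y \<in> proj i ` T")
      case False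
      have "vdim (U \<inter> H i) \<le> vdim (U' \<inter> H i)"
        using U' T(3) H_subspace[OF i] by (intro dim_mono inter_subspace) auto
      then show ?thesis using False T(6)[OF i] finT yT by simp
    next
      case True
      then obtain z where z: "z \<in> T" "proj i y = proj i z" by blast
      then have zS: "z \<in> S" using T by blast
      \<comment> \<open>A collision of y with z puts y - z into \<open>H i\<close>. This difference
        lies in \<open>U'\<close> but not in \<open>U\<close>, so the intersection with
        \<open>H i\<close> grows and pays for the lost symbol.\<close>
      have yz: "y \<ominus>\<^bsub>M\<^esub> z \<in> H i" using z zS y S proj_eq_iff[OF i, of y z] by blast
      have "(y \<ominus>\<^bsub>M\<^esub> x0) \<ominus>\<^bsub>M\<^esub> (z \<ominus>\<^bsub>M\<^esub> x0) \<in> U'"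
        using subspaceD(7)[OF U'(1)] U'(3,4) T(5)[OF z(1)] by blast
      then have "y \<ominus>\<^bsub>M\<^esub> z \<in> U'" using diff_minus_diff list_carrier y(1) zS x0 by simp
      moreover have "y \<ominus>\<^bsub>M\<^esub> z \<notin> U"
      proof
        assume "y \<ominus>\<^bsub>M\<^esub> z \<in> U"
        then have "(y \<ominus>\<^bsub>M\<^esub> z) \<oplus>\<^bsub>M\<^esub> (z \<ominus>\<^bsub>M\<^esub> x0) \<in> U" using subspaceD(5)[OF T(3)] T(5)[OF z(1)] by blast
        then show False using y(2) diff_plus_diff list_carrier y(1) zS x0 by simp
      qed
      ultimately have "U \<inter> H i \<subset> U' \<inter> H i" using yz U'(3) by blast
      then have "vdim (U \<inter> H i) < vdim (U' \<inter> H i)"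
        using U' T(3) H_subspace[OF i] by (intro dim_strict_mono inter_subspace) auto
      then show ?thesis using True T(6)[OF i] finT yT by (simp add: insert_absorb)
    qed
    then have "indep (insert y T) U'"
      using T U' y(1) finT yT by (auto simp: indep_def)
    then show ?thesis using U'(2) by blast
  qed
  \<comment> \<open>Growth either reaches dimension \<open>j\<close> or stops earlier because all of
    \<open>S\<close> is already covered.\<close>
  have step: "(\<exists>T U. indep T U \<and> vdim U = j) \<or>
    (\<exists>U\<in>subspaces. vdim U < j \<and> (\<forall>x\<in>S. x \<ominus>\<^bsub>M\<^esub> x0 \<in> U))" for j
  proof (induction j)
    case 0
    have "x0 \<ominus>\<^bsub>M\<^esub> x0 = \<zero>\<^bsub>M\<^esub>" using list_carrier[OF x0] by (simp add: a_minus_def M.r_neg)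
    then have "indep {x0} {\<zero>\<^bsub>M\<^esub>}" using x0 zero_subspace by (simp add: indep_def vdim_zero)
    then show ?case using vdim_zero by blast
  next
    case (Suc j)
    then consider T U where "indep T U" "vdim U = j"
      | U where "U \<in> subspaces" "vdim U < j" "\<forall>x\<in>S. x \<ominus>\<^bsub>M\<^esub> x0 \<in> U" by blast
    then show ?case
    proof cases
      case (1 T U)
      show ?thesis
      proof (cases "\<forall>x\<in>S. x \<ominus>\<^bsub>M\<^esub> x0 \<in> U")
        case True
        then show ?thesis using 1 by (auto simp: indep_def)
      next
        case False
        then show ?thesis using extend 1 by metis
      qed
    next
      case 2
      then show ?thesis using less_SucI by blast
    qed
  qed
  have False if TU: "indep T U" and dim: "vdim U = D" for T U
  proof -
    have T: "T \<subseteq> S" "U \<in> subspaces" "card T = Suc D"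
      "\<And>i. i < n \<Longrightarrow> card T \<le> card (proj i ` T) + vdim (U \<inter> H i)"
      using TU dim by (auto simp: indep_def)
    have finT: "finite T" using T(1) list_finite finite_subset by blast
    \<comment> \<open>Elements of \<open>T\<close> that hit the list show at most \<open>l\<close>
      symbols, the others at most one each; any excess over \<open>l\<close> must therefore be made
      up of collisions.\<close>
    have "card {x \<in> T. proj i x \<in> L i} \<le> l + vdim (U \<inter> H i)" if i: "i < n" for i
    proof -
      let ?T1 = "{x \<in> T. proj i x \<in> L i}" and ?T2 = "{x \<in> T. proj i x \<notin> L i}"
      have "card T = card ?T1 + card ?T2"
        using finT by (subst card_Un_disjoint[symmetric]) (auto intro!: arg_cong[of _ _ card])
      moreover have "card (proj i ` T) \<le> card (L i) + card (proj i ` ?T2)"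
        using finT L[OF i] by (intro order_trans[OF card_mono card_Un_le]) auto
      moreover have "card (proj i ` ?T2) \<le> card ?T2" using finT by (intro card_image_le) auto
      ultimately show ?thesis using T(4)[OF i] L[OF i] by linarith
    qed
    then have "(\<Sum>i<n. real (card {x \<in> T. proj i x \<in> L i})) \<le> (\<Sum>i<n. real l + real (vdim (U \<inter> H i)))"
      by (intro sum_mono) (metis lessThan_iff of_nat_add of_nat_mono)
    also have "\<dots> \<le> real n * real l + \<tau> * real n * real D"
      using design[OF T(2)] dim by (simp add: sum.distrib)
    finally have "\<rho> * real n * real (Suc D) \<le> real n * real l + \<tau> * real n * real D"
      using agreement_double_count[OF T(1)] T(3) by simp
    then have "real n * (real D * (\<rho> - \<tau>) + \<rho>) \<le> real n * real l" by (simp add: algebra_simps)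
    then show False using D n_pos by simp
  qed
  then obtain U where U: "U \<in> subspaces" "vdim U < D" "\<forall>x\<in>S. x \<ominus>\<^bsub>M\<^esub> x0 \<in> U"
    using step[of D] by blast
  moreover have "x \<ominus>\<^bsub>M\<^esub> y \<in> U" if "x \<in> S" "y \<in> S" for x y
    using subspaceD(7)[OF U(1), of "x \<ominus>\<^bsub>M\<^esub> x0" "y \<ominus>\<^bsub>M\<^esub> x0"] U(3) that x0 diff_minus_diff list_carrier by auto
  ultimately show ?thesis using that by blast
qed

text \<open>The convex function m ln m is replaced by its tangent at a = \<rho> N / l, the mean
  multiplicity of a listed symbol when the agreement is exactly \<rho>. The assumption
  \<open>large\<close> says that the slope 1 + ln a is nonnegative, so that the lower bound on the
  total agreement may be inserted.\<close>

lemma list_entropy_bound: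
  assumes U: "U \<in> subspaces" "vdim U \<le> D"
    and diff: "\<And>x y. x \<in> S \<Longrightarrow> y \<in> S \<Longrightarrow> x \<ominus>\<^bsub>M\<^esub> y \<in> U"
    and l_pos: "0 < l" and large: "exp (-1) \<le> \<rho> * real (card S) / real l"
  shows "\<rho> * ln (\<rho> * real (card S) / real l) \<le> \<tau> * ln (real (card S))"
proof -
  define N where "N = real (card S)"
  define a where "a = \<rho> * N / real l"
  have a_pos: "0 < a" using large exp_gt_zero[of "-1::real"] unfolding a_def N_def by linarith
  have lna: "0 \<le> 1 + ln a"
    using large a_pos ln_ge_iff[of a "-1"] unfolding a_def N_def by linarith
  have N_pos: "0 < N" using S_ne list_finite by (simp add: N_def card_gt_0_iff)
  have tangent: "real m * (1 + ln a) - a \<le> real m * ln (real m)" for m :: nat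
  proof (cases "m = 0")
    case False
    then have "ln (a / real m) \<le> a / real m - 1" using a_pos by (intro ln_le_minus_one) simp
    then have "real m * (ln a - ln (real m)) \<le> real m * (a / real m - 1)"
      using False a_pos by (intro mult_left_mono) (simp_all add: ln_div)
    then show ?thesis using False by (simp add: algebra_simps)
  qed (use a_pos in simp)
  have "(1 + ln a) * real (card {x \<in> S. proj i x \<in> L i}) - real l * a
    \<le> (\<Sum>x\<in>S. ln (real (card {y \<in> S. proj i y = proj i x})))" if i: "i < n" for i
  proof -
    let ?m = "\<lambda>v. card {y \<in> S. proj i y = v}"
    let ?S = "{x \<in> S. proj i x \<in> L i}"
    have fL: "finite (L i)" "card (L i) = l" using L[OF i] by auto
    have group: "(\<Sum>v\<in>L i. \<Sum>x\<in>{x \<in> ?S. proj i x = v}. f x) = (\<Sum>x\<in>?S. f x)" for f :: "_ \<Rightarrow> real"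
      using list_finite fL by (intro sum.group) auto
    have fib: "{x \<in> ?S. proj i x = v} = {y \<in> S. proj i y = v}" if "v \<in> L i" for v using that by auto
    have card_eq: "(\<Sum>v\<in>L i. real (?m v)) = real (card ?S)"
      using group[of "\<lambda>_. 1"] fib by simp
    have "(1 + ln a) * real (card ?S) - real l * a = (\<Sum>v\<in>L i. real (?m v) * (1 + ln a) - a)"
      by (simp add: sum_subtractf fL card_eq[symmetric] sum_distrib_left mult.commute)
    also have "\<dots> \<le> (\<Sum>v\<in>L i. real (?m v) * ln (real (?m v)))"
      by (intro sum_mono tangent)
    also have "\<dots> = (\<Sum>v\<in>L i. \<Sum>x\<in>{x \<in> ?S. proj i x = v}. ln (real (?m (proj i x))))"
    proof (intro sum.cong refl)
      fix v assume v: "v \<in> L i"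
      have "(\<Sum>x\<in>{x \<in> ?S. proj i x = v}. ln (real (?m (proj i x))))
        = (\<Sum>x\<in>{y \<in> S. proj i y = v}. ln (real (?m v)))"
        unfolding fib[OF v] by (intro sum.cong) auto
      then show "real (?m v) * ln (real (?m v))
        = (\<Sum>x\<in>{x \<in> ?S. proj i x = v}. ln (real (?m (proj i x))))"
        unfolding sum_constant by (rule sym)
    qed
    also have "\<dots> = (\<Sum>x\<in>?S. ln (real (?m (proj i x))))" by (rule group)
    \<comment> \<open>Symbols outside \<open>L i\<close> only add terms ln m with m \<ge> 1.\<close>
    also have "\<dots> \<le> (\<Sum>x\<in>S. ln (real (?m (proj i x))))"
    proof (rule sum_mono2[OF list_finite])
      fix x assume "x \<in> S - ?S"
      then have "0 < ?m (proj i x)" using list_finite by (auto simp: card_gt_0_iff)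
      then show "0 \<le> ln (real (?m (proj i x)))" by simp
    qed auto
    finally show ?thesis .
  qed
  then have "(\<Sum>i<n. (1 + ln a) * real (card {x \<in> S. proj i x \<in> L i}) - real l * a)
    \<le> (\<Sum>i<n. \<Sum>x\<in>S. ln (real (card {y \<in> S. proj i y = proj i x})))"
    by (intro sum_mono) simp
  also have "\<dots> \<le> \<tau> * real n * (N * ln N)"
    unfolding N_def by (rule entropy_design[OF S U diff])
  finally have "(1 + ln a) * (\<Sum>i<n. real (card {x \<in> S. proj i x \<in> L i})) - real n * (real l * a)
    \<le> \<tau> * real n * (N * ln N)"
    by (simp add: sum_subtractf sum_distrib_left)
  moreover have "(1 + ln a) * (\<rho> * real n * N) \<le> (1 + ln a) * (\<Sum>i<n. real (card {x \<in> S. proj i x \<in> L i}))"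
    using agreement_double_count[of S] lna by (intro mult_left_mono) (simp_all add: N_def)
  moreover have la: "real l * a = \<rho> * N" using l_pos by (simp add: a_def)
  ultimately have "(1 + ln a) * (\<rho> * real n * N) - real n * (\<rho> * N) \<le> \<tau> * real n * (N * ln N)"
    unfolding la by linarith
  then have "(real n * N) * (\<rho> * ln a) \<le> (real n * N) * (\<tau> * ln N)"
    by (simp add: algebra_simps)
  then have "\<rho> * ln a \<le> \<tau> * ln N" using n_pos N_pos by simp
  then show ?thesis by (simp add: a_def N_def)
qed

text \<open>Coordinates with \<open>U \<subseteq> H i\<close> do not split the list and have to be counted separately.\<close>

lemma unique_list_bound:
  assumes l: "l = 1" and \<rho>: "\<rho> \<le> 1"
  shows "U \<in> subspaces \<Longrightarrow> vdim U \<le> D \<Longrightarrow> T \<subseteq> S \<Longrightarrow>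
    (\<And>x y. x \<in> T \<Longrightarrow> y \<in> T \<Longrightarrow> x \<ominus>\<^bsub>M\<^esub> y \<in> U) \<Longrightarrow>
    real (card T) \<le> 1 + (1 - \<rho>) / (\<rho> - \<tau>) * real (vdim U)"
proof (induction "vdim U" arbitrary: U T rule: less_induct)
  case less
  \<comment> \<open>Chosen so that c (\<rho> - \<tau>) = 1 - \<rho>; the error term at the end is
    then a multiple of (1 - d) (1 - \<rho>), which is at most 0.\<close>
  define c where "c = (1 - \<rho>) / (\<rho> - \<tau>)"
  have c: "0 \<le> c" "c * (\<rho> - \<tau>) = 1 - \<rho>" using gap \<rho> by (auto simp: c_def)
  have finT: "finite T" using less.prems(3) list_finite finite_subset by blast
  show ?case
  proof (cases "vdim U = 0")
    case True
    have "U = {\<zero>\<^bsub>M\<^esub>}"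
      using True dim_strict_mono[OF zero_subspace less.prems(1)] subspaceD(4)[OF less.prems(1)] by auto
    then have "x = y" if "x \<in> T" "y \<in> T" for x y
      using less.prems(4)[OF that] that less.prems(3) list_carrier by (auto intro: diff_zero_eq)
    then have "card T \<le> 1" using finT by (metis One_nat_def card_le_Suc0_iff_eq)
    then show ?thesis using True by simp
  next
    case False
    define d where "d = real (vdim U)"
    have d: "1 \<le> d" using False by (simp add: d_def)
    define B where "B = {i \<in> {..<n}. U \<subseteq> H i}"
    define b where "b = real (card B)"
    define N where "N = real (card T)"
    have B: "B \<subseteq> {..<n}" "finite B" by (auto simp: B_def)
    have bn: "real (card ({..<n} - B)) = real n - b"
      using B card_mono[OF finite_lessThan B(1)] by (simp add: card_Diff_subset b_def)
    have split: "(\<Sum>i<n. f i) = (\<Sum>i\<in>B. f i) + (\<Sum>i\<in>{..<n} - B. f i)" for f :: "nat \<Rightarrow> real"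
      using B by (simp add: sum.subset_diff)
    have "(\<Sum>i<n. real (vdim (U \<inter> H i))) = b * d + (\<Sum>i\<in>{..<n} - B. real (vdim (U \<inter> H i)))"
    proof -
      have "(\<Sum>i\<in>B. real (vdim (U \<inter> H i))) = (\<Sum>i\<in>B. d)"
        by (intro sum.cong refl) (auto simp: B_def d_def Int_absorb2)
      then show ?thesis by (simp add: split b_def)
    qed
    then have dims: "b * d + (\<Sum>i\<in>{..<n} - B. real (vdim (U \<inter> H i))) \<le> \<tau> * real n * d"
      using design[OF less.prems(1,2)] by (simp add: d_def)
    \<comment> \<open>The design property also limits the number \<open>b\<close> of coordinates
      that do not split: b < \<rho> n, so the coefficient \<rho> n - b of \<open>N\<close> is
      positive.\<close>
    have "0 \<le> (\<Sum>i\<in>{..<n} - B. real (vdim (U \<inter> H i)))" by (intro sum_nonneg) simp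
    then have "b * d \<le> (\<tau> * real n) * d" using dims by simp
    then have "b \<le> \<tau> * real n" using d by simp
    also have "\<dots> < \<rho> * real n" using gap n_pos by simp
    finally have b_lt: "b < \<rho> * real n" .
    \<comment> \<open>Elements that carry the single listed symbol differ by elements of
      \<open>H i\<close>, and U \<inter> H i is smaller than \<open>U\<close> outside
      \<open>B\<close>, so the induction hypothesis applies to them.\<close>
    have "real (card {x \<in> T. proj i x \<in> L i}) \<le> 1 + c * real (vdim (U \<inter> H i))"
      if i: "i \<in> {..<n} - B" for i
      unfolding c_def
    proof (rule less.hyps)
      have i': "i < n" "\<not> U \<subseteq> H i" using i by (auto simp: B_def)
      show UH: "U \<inter> H i \<in> subspaces" using less.prems(1) H_subspace i' by (intro inter_subspace)
      show "vdim (U \<inter> H i) < vdim U" using UH less.prems(1) i' by (intro dim_strict_mono) auto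
      then show "vdim (U \<inter> H i) \<le> D" using less.prems(2) by simp
      show "{x \<in> T. proj i x \<in> L i} \<subseteq> S" using less.prems(3) by auto
      obtain v where v: "L i = {v}" using L[OF i'(1)] l by (auto simp: card_1_singleton_iff)
      fix x y assume "x \<in> {x \<in> T. proj i x \<in> L i}" "y \<in> {x \<in> T. proj i x \<in> L i}"
      then have xy: "x \<in> T" "y \<in> T" "proj i x = proj i y" using v by auto
      then have "x \<in> V" "y \<in> V" using less.prems(3) S by auto
      then have "x \<ominus>\<^bsub>M\<^esub> y \<in> H i" using proj_eq_iff[OF i'(1)] xy by blast
      then show "x \<ominus>\<^bsub>M\<^esub> y \<in> U \<inter> H i" using less.prems(4) xy by blast
    qed
    then have "(\<Sum>i\<in>{..<n} - B. real (card {x \<in> T. proj i x \<in> L i}))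
      \<le> (\<Sum>i\<in>{..<n} - B. 1 + c * real (vdim (U \<inter> H i)))"
      by (rule sum_mono)
    also have "\<dots> = (real n - b) + c * (\<Sum>i\<in>{..<n} - B. real (vdim (U \<inter> H i)))"
      by (simp add: sum.distrib bn sum_distrib_left)
    also have "\<dots> \<le> (real n - b) + c * (\<tau> * real n * d - b * d)"
      using dims c by (intro add_left_mono mult_left_mono) auto
    finally have "(\<Sum>i\<in>{..<n} - B. real (card {x \<in> T. proj i x \<in> L i}))
      \<le> (real n - b) + c * (\<tau> * real n * d - b * d)" .
    moreover have "(\<Sum>i\<in>B. real (card {x \<in> T. proj i x \<in> L i})) \<le> (\<Sum>i\<in>B. N)"
      using finT by (intro sum_mono) (auto simp: N_def intro!: card_mono)
    ultimately have "\<rho> * real n * N \<le> b * N + (real n - b) + c * (\<tau> * real n * d - b * d)"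
      using agreement_double_count[OF less.prems(3)] split by (simp add: N_def b_def)
    then have "N * (\<rho> * real n - b) \<le> (real n - b) + c * d * (\<tau> * real n - b)"
      by (simp add: algebra_simps)
    also have "\<dots> = (1 + c * d) * (\<rho> * real n - b) + real n * ((1 - \<rho>) - d * (c * (\<rho> - \<tau>)))"
      by (simp add: algebra_simps)
    also have "\<dots> \<le> (1 + c * d) * (\<rho> * real n - b)"
    proof -
      have "1 * (1 - \<rho>) \<le> d * (1 - \<rho>)" using d \<rho> by (intro mult_right_mono) auto
      then have "(1 - \<rho>) - d * (c * (\<rho> - \<tau>)) \<le> 0" unfolding c(2) by simp
      then show ?thesis using mult_nonneg_nonpos[of "real n"] by simp
    qed
    finally have "N \<le> 1 + c * d" using b_lt by simp
    then show ?thesis by (simp add: N_def c_def d_def)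
  qed
qed

end

end

subsection \<open>Polynomials over a finite field\<close>

text \<open>Coefficient functions are the working model of polynomials because they form a module
  over the field; the coefficient lists of the code are translated into them when the code is
  described.\<close>

locale finite_field_poly = UP_domain R P + R?: field R
  for R :: "('a, 'm) ring_scheme" (structure) and P (structure) +
  assumes finite_field: "finite (carrier R)"
begin

abbreviation cf :: "(nat \<Rightarrow> 'a) \<Rightarrow> nat \<Rightarrow> 'a" where "cf \<equiv> up_ring.coeff P"
abbreviation ev :: "'a \<Rightarrow> (nat \<Rightarrow> 'a) \<Rightarrow> 'a" where "ev \<equiv> UnivPoly.eval R R id"

definition polys :: "nat \<Rightarrow> (nat \<Rightarrow> 'a) set" where
  "polys N = {f \<in> carrier P. \<forall>j\<ge>N. cf f j = \<zero>}"

lemma polys_carrier: "f \<in> polys N \<Longrightarrow> f \<in> carrier P"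
  by (simp add: polys_def)

lemma polys_coeff: "f \<in> polys N \<Longrightarrow> N \<le> j \<Longrightarrow> cf f j = \<zero>"
  by (simp add: polys_def)

lemma carrier_iff: "f \<in> carrier P \<longleftrightarrow> f \<in> up R"
  by (simp add: P_def UP_def)

lemma cf_apply: "f \<in> carrier P \<Longrightarrow> cf f j = f j"
  by (simp add: P_def UP_def)

lemma polysI:
  assumes "\<And>j. j < N \<Longrightarrow> f j \<in> carrier R" "\<And>j. N \<le> j \<Longrightarrow> f j = \<zero>"
  shows "f \<in> polys N" "cf f j = f j"
proof -
  have "bound \<zero> N f" using assms(2) by (simp add: bound_def)
  then have "f \<in> up R" using assms by (intro mem_upI) (metis not_le R.zero_closed, blast)
  then show "f \<in> polys N" "cf f j = f j" using assms(2) by (simp_all add: polys_def carrier_iff cf_apply)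
qed

lemma deg_polys: "f \<in> polys N \<Longrightarrow> f \<noteq> \<zero>\<^bsub>P\<^esub> \<Longrightarrow> deg R f < N"
  using lcoeff_nonzero2[of f] unfolding polys_def by (metis (mono_tags, lifting) mem_Collect_eq not_le)

lemma card_polys: "card (polys N) = card (carrier R) ^ N"
proof -
  have "bij_betw (\<lambda>f. restrict (cf f) {..<N}) (polys N) ({..<N} \<rightarrow>\<^sub>E carrier R)"
  proof (intro bij_betw_imageI subset_antisym)
    show "inj_on (\<lambda>f. restrict (cf f) {..<N}) (polys N)"
    proof (rule inj_onI)
      fix f g assume fg: "f \<in> polys N" "g \<in> polys N" "restrict (cf f) {..<N} = restrict (cf g) {..<N}"
      have "cf f j = cf g j" for j
      proof (cases "j < N")
        case True
        then show ?thesis using fun_cong[OF fg(3), of j] by simp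
      next
        case False
        then show ?thesis using fg by (simp add: polys_coeff)
      qed
      then show "f = g" using fg by (intro up_eqI) (auto simp: polys_carrier)
    qed
    show "(\<lambda>f. restrict (cf f) {..<N}) ` polys N \<subseteq> {..<N} \<rightarrow>\<^sub>E carrier R"
      by (auto simp: polys_carrier split: if_splits)
    show "{..<N} \<rightarrow>\<^sub>E carrier R \<subseteq> (\<lambda>f. restrict (cf f) {..<N}) ` polys N"
    proof
      fix g assume g: "g \<in> {..<N} \<rightarrow>\<^sub>E carrier R"
      define f where "f j = (if j < N then g j else \<zero>)" for j
      have gv: "f j \<in> carrier R" if "j < N" for j using PiE_mem[OF g] that by (simp add: f_def)
      have f: "f \<in> polys N" by (rule polysI(1)[OF gv]) (simp_all add: f_def)
      have "cf f j = f j" for j using cf_apply[OF polys_carrier[OF f]] .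
      then have "g = restrict (cf f) {..<N}"
        using PiE_arb[OF g] by (intro ext) (simp add: f_def restrict_def)
      then show "g \<in> (\<lambda>f. restrict (cf f) {..<N}) ` polys N" using f by blast
    qed
  qed
  from bij_betw_same_card[OF this] show ?thesis by (simp add: card_funcsetE)
qed

lemma finite_polys: "finite (polys N)"
proof (rule card_ge_0_finite)
  have "carrier R \<noteq> {}" by blast
  then show "0 < card (polys N)" using finite_field by (simp add: card_polys card_gt_0_iff)
qed

lemma zero_polys: "\<zero>\<^bsub>P\<^esub> \<in> polys N" by (simp add: polys_def)

lemma add_polys: "f \<in> polys N \<Longrightarrow> g \<in> polys N \<Longrightarrow> f \<oplus>\<^bsub>P\<^esub> g \<in> polys N"
  by (simp add: polys_def)

lemma minus_polys: "f \<in> polys N \<Longrightarrow> g \<in> polys N \<Longrightarrow> f \<ominus>\<^bsub>P\<^esub> g \<in> polys N"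
  by (simp add: polys_def a_minus_def)

lemma smult_polys: "a \<in> carrier R \<Longrightarrow> f \<in> polys N \<Longrightarrow> a \<odot>\<^bsub>P\<^esub> f \<in> polys N"
  by (simp add: polys_def)

lemma ev_closed: "x \<in> carrier R \<Longrightarrow> f \<in> carrier P \<Longrightarrow> ev x f \<in> carrier R"
  by (rule carrier_evalRR)

lemma ev_smult:
  assumes "a \<in> carrier R" "x \<in> carrier R" "f \<in> carrier P"
  shows "ev x (a \<odot>\<^bsub>P\<^esub> f) = a \<otimes> ev x f"
proof -
  have "ev x (a \<odot>\<^bsub>P\<^esub> f) = ev x (up_ring.monom P a 0 \<otimes>\<^bsub>P\<^esub> f)"
    using assms by (simp add: monom_mult_is_smult)
  also have "\<dots> = a \<otimes> ev x f"
    using assms by (simp add: evalRR_mult evalRR_monom)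
  finally show ?thesis .
qed

lemma ev_zero: "x \<in> carrier R \<Longrightarrow> ev x \<zero>\<^bsub>P\<^esub> = \<zero>"
  using evalRR_sub[of "\<zero>\<^bsub>P\<^esub>" "\<zero>\<^bsub>P\<^esub>" x] ev_closed[of x "\<zero>\<^bsub>P\<^esub>"]
  by (simp add: a_minus_def R.r_neg)

lemma ev_polys:
  assumes f: "f \<in> polys N" and x: "x \<in> carrier R"
  shows "ev x f = (\<Oplus>j\<in>{..<N}. cf f j \<otimes> x [^] j)"
proof -
  have fc: "f \<in> carrier P" using f by (rule polys_carrier)
  have "(\<Oplus>j\<in>{..deg R f}. cf f j \<otimes> x [^] j) = (\<Oplus>j\<in>{..<N}. cf f j \<otimes> x [^] j)"
    by (rule R.add.finprod_mono_neutral_cong) (use fc x f in \<open>auto simp: polys_coeff deg_aboveD\<close>)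
  then show ?thesis using fc by (simp add: eval_on_carrier)
qed

lemma polys_eq_zeroI:
  assumes f: "f \<in> polys N" and A: "A \<subseteq> carrier R" "N \<le> card A"
    and zero: "\<And>x. x \<in> A \<Longrightarrow> ev x f = \<zero>"
  shows "f = \<zero>\<^bsub>P\<^esub>"
proof (rule ccontr)
  assume nz: "f \<noteq> \<zero>\<^bsub>P\<^esub>"
  have "A \<subseteq> {a \<in> carrier R. ev a f = \<zero>}" using A zero by auto
  then have "card A \<le> card {a \<in> carrier R. ev a f = \<zero>}"
    using finite_field by (intro card_mono) auto
  also have "\<dots> \<le> deg R f" using roots_bound[OF polys_carrier[OF f] nz finite_field] by simp
  also have "\<dots> < N" using deg_polys[OF f nz] .
  finally show False using A by simp
qed

text \<open>The polynomial f(c X). It turns the evaluation of \<open>f\<close> at \<gamma>^t x into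
  the evaluation of another polynomial at x.\<close>

definition dilate :: "'a \<Rightarrow> (nat \<Rightarrow> 'a) \<Rightarrow> nat \<Rightarrow> 'a" where
  "dilate c f = (\<lambda>j. cf f j \<otimes> c [^] j)"

lemma dilate:
  assumes "f \<in> polys N" "c \<in> carrier R"
  shows dilate_polys: "dilate c f \<in> polys N" and coeff_dilate: "cf (dilate c f) j = cf f j \<otimes> c [^] j"
  using assms polysI(1)[of N "dilate c f"] polysI(2)[of N "dilate c f" j]
  by (auto simp: dilate_def polys_coeff polys_carrier)

lemma ev_dilate:
  assumes f: "f \<in> polys N" and c: "c \<in> carrier R" and x: "x \<in> carrier R"
  shows "ev x (dilate c f) = ev (c \<otimes> x) f"
  unfolding ev_polys[OF dilate_polys[OF f c] x] ev_polys[OF f R.m_closed[OF c x]]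
  using f c x by (intro R.finsum_cong') (auto simp: coeff_dilate[OF f c] polys_carrier R.nat_pow_distrib R.m_assoc)

text \<open>\<open>a\<close> and \<open>b\<close> only bound the degrees, so either coefficient may
  vanish: one common top exponent can serve a whole family of polynomials.\<close>

lemma coeff_mult_top:
  assumes f: "f \<in> carrier P" "\<And>j. a < j \<Longrightarrow> cf f j = \<zero>"
    and g: "g \<in> carrier P" "\<And>j. b < j \<Longrightarrow> cf g j = \<zero>"
  shows "cf (f \<otimes>\<^bsub>P\<^esub> g) (a + b) = cf f a \<otimes> cf g b"
proof -
  have "cf f i \<otimes> cf g (a + b - i) = (if a = i then cf f i \<otimes> cf g (a + b - i) else \<zero>)" for i
  proof (cases i a rule: linorder_cases)
    case less
    then show ?thesis using f(1) g by simp
  next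
    case greater
    then show ?thesis using f g(1) by simp
  qed simp
  then have "cf (f \<otimes>\<^bsub>P\<^esub> g) (a + b)
    = (\<Oplus>i\<in>{..a + b}. if a = i then cf f i \<otimes> cf g (a + b - i) else \<zero>)"
    using f g by (simp cong: R.finsum_cong)
  also have "\<dots> = cf f a \<otimes> cf g b"
    using f g R.finsum_singleton[of a "{..a + b}" "\<lambda>i. cf f i \<otimes> cf g (a + b - i)"] by simp
  finally show ?thesis .
qed

lemma mult_polys:
  assumes f: "f \<in> polys M" and g: "g \<in> polys N" and K: "M + N \<le> K + 1"
  shows "f \<otimes>\<^bsub>P\<^esub> g \<in> polys K"
proof -
  have "cf (f \<otimes>\<^bsub>P\<^esub> g) j = \<zero>" if j: "K \<le> j" for j
  proof -
    have "cf f i \<otimes> cf g (j - i) = \<zero>" for i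
    proof (cases "M \<le> i")
      case True
      then show ?thesis using f g by (simp add: polys_coeff polys_carrier)
    next
      case False
      then have "N \<le> j - i" using j K by simp
      then show ?thesis using f g by (simp add: polys_coeff polys_carrier)
    qed
    then show ?thesis using f g by (simp add: polys_carrier)
  qed
  then show ?thesis using f g by (simp add: polys_def)
qed

lemma finite_vector_space_polys: "finite_vector_space R P (polys N)"
proof (intro finite_vector_space.intro finite_vector_space_axioms.intro)
  show "module R P" by (rule module)
  show "field R" by unfold_locales
  show "finite (carrier R)" by (rule finite_field)
  show "finite (polys N)" by (rule finite_polys)
  show "submodule (polys N) R P"
    by (rule submoduleI) (auto simp: polys_def)
qed

end

subsection \<open>The folded Wronskian argument\<close>

text \<open>\<open>HOL-Algebra\<close> has two constants \<open>mult_of\<close> with the same definition; the results on orders are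
  about the one of \<open>Multiplicative_Group\<close>.\<close>

locale folded_code = finite_field_poly R P
  for R :: "('a, 'm) ring_scheme" (structure) and P (structure) +
  fixes n k s :: nat and \<gamma> :: 'a and \<alpha> :: "nat \<Rightarrow> 'a"
  assumes n_pos: "0 < n" and k_pos: "0 < k" and s_pos: "0 < s"
    and \<gamma>: "\<gamma> \<in> carrier R" "\<gamma> \<noteq> \<zero>"
    and \<alpha>: "\<And>i. i < n \<Longrightarrow> \<alpha> i \<in> carrier R" "\<And>i. i < n \<Longrightarrow> \<alpha> i \<noteq> \<zero>"
    and shifts_distinct: "\<And>i j t. i < n \<Longrightarrow> j < n \<Longrightarrow> t < s \<Longrightarrow> i \<noteq> j \<Longrightarrow> \<alpha> i \<otimes> \<gamma> [^] t \<noteq> \<alpha> j"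
    and min_le_ord: "min k (s * n) \<le> group.ord (Multiplicative_Group.mult_of R) \<gamma>"
begin

sublocale vs: finite_vector_space R P "polys k"
  by (rule finite_vector_space_polys)

abbreviation "ord_\<gamma> \<equiv> group.ord (Multiplicative_Group.mult_of R) \<gamma>"

definition point :: "nat \<Rightarrow> nat \<Rightarrow> 'a" where "point i t = \<alpha> i \<otimes> \<gamma> [^] t"

definition H :: "nat \<Rightarrow> (nat \<Rightarrow> 'a) set" where
  "H i = {f \<in> polys k. \<forall>t<s. ev (point i t) f = \<zero>}"

definition symbol :: "nat \<Rightarrow> (nat \<Rightarrow> 'a) \<Rightarrow> nat \<Rightarrow> 'a" where
  "symbol i f = (\<lambda>t\<in>{..<s}. ev (point i t) f)"

lemma point_closed: "i < n \<Longrightarrow> point i t \<in> carrier R"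
  using \<alpha> \<gamma> by (simp add: point_def)

lemma H_subspace: "i < n \<Longrightarrow> H i \<in> vs.subspaces"
  by (rule vs.subspaceI)
    (auto simp: H_def zero_polys add_polys smult_polys ev_zero evalRR_add ev_smult point_closed polys_carrier)

lemma symbol_eq_iff:
  assumes "i < n" "f \<in> polys k" "g \<in> polys k"
  shows "symbol i f = symbol i g \<longleftrightarrow> f \<ominus>\<^bsub>P\<^esub> g \<in> H i"
proof -
  have "symbol i f = symbol i g \<longleftrightarrow> (\<forall>t<s. ev (point i t) f = ev (point i t) g)"
    by (auto simp: symbol_def restrict_def fun_eq_iff)
  also have "\<dots> \<longleftrightarrow> f \<ominus>\<^bsub>P\<^esub> g \<in> H i"
    using assms by (simp add: H_def minus_polys evalRR_sub point_closed polys_carrier ev_closed)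
  finally show ?thesis .
qed

lemma pow_inj: "inj_on (\<lambda>t::nat. \<gamma> [^] t) {..<ord_\<gamma>}"
proof -
  have "\<gamma> \<in> carrier (Multiplicative_Group.mult_of R)" using \<gamma> by simp
  from group.ord_inj[OF field_mult_group this]
  have "inj_on (\<lambda>t::nat. \<gamma> [^] t) {0..ord_\<gamma> - 1}" by (simp add: Multiplicative_Group.nat_pow_mult_of)
  then show ?thesis by (rule inj_on_subset) auto
qed

lemma pow_nonzero: "\<gamma> [^] (t::nat) \<noteq> \<zero>"
  using \<gamma> by (induction t) (auto simp: R.integral_iff)

text \<open>If \<alpha> i \<gamma>^u = \<alpha> j \<gamma>^v with v \<le> u, cancelling \<gamma>^v
  leaves a shift by u - v < s. The shift condition forces i = j, and the order of \<gamma> forces u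
  = v.\<close>

lemma point_inj:
  assumes "m \<le> s" "m \<le> ord_\<gamma>"
  shows "inj_on (\<lambda>(i, t). point i t) ({..<n} \<times> {..<m})"
proof -
  have aux: "i = j \<and> u = v"
    if "i < n" "j < n" "u < m" "v \<le> u" "point i u = point j v" for i j u v
  proof -
    have "(\<alpha> i \<otimes> \<gamma> [^] (u - v)) \<otimes> \<gamma> [^] v = \<alpha> j \<otimes> \<gamma> [^] v"
      using that \<alpha> \<gamma> by (simp add: point_def R.m_assoc R.nat_pow_mult)
    then have eq: "\<alpha> i \<otimes> \<gamma> [^] (u - v) = \<alpha> j"
      using that \<alpha> \<gamma> pow_nonzero[of v]
        R.m_rcancel[of "\<gamma> [^] v" "\<alpha> i \<otimes> \<gamma> [^] (u - v)" "\<alpha> j"] by simp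
    moreover have "u - v < s" using that assms by simp
    ultimately have ij: "i = j" using shifts_distinct[of i j "u - v"] that(1,2) by blast
    then have "\<alpha> i \<otimes> \<gamma> [^] (u - v) = \<alpha> i \<otimes> \<gamma> [^] (0::nat)" using eq that \<alpha> by simp
    then have "\<gamma> [^] (u - v) = \<gamma> [^] (0::nat)"
      using that \<alpha> \<gamma> R.m_lcancel[of "\<alpha> i" "\<gamma> [^] (u - v)" "\<gamma> [^] (0::nat)"] by simp
    then have "u - v = 0" using that assms by (intro inj_onD[OF pow_inj]) auto
    then show ?thesis using ij that by simp
  qed
  show ?thesis
  proof (rule inj_onI)
    fix p p' assume p: "p \<in> {..<n} \<times> {..<m}" "p' \<in> {..<n} \<times> {..<m}"
      and eq: "(case p of (i, t) \<Rightarrow> point i t) = (case p' of (i, t) \<Rightarrow> point i t)"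
    obtain i u j v where "p = (i, u)" "p' = (j, v)" by (cases p, cases p')
    then show "p = p'"
      using p eq aux[of i j u v] aux[of j i v u] by (cases "v \<le> u") auto
  qed
qed

section \<open>Degrees in a subspace and the pairing with shifted evaluations\<close>

definition degrees :: "(nat \<Rightarrow> 'a) set \<Rightarrow> nat set" where
  "degrees W = deg R ` (W - {\<zero>\<^bsub>P\<^esub>})"

text \<open>An element of \<open>W\<close> is determined by its coefficients at the degrees attained
  in \<open>W\<close>, since a nonzero difference of two elements has its leading coefficient at one
  of them.\<close>

lemma vdim_le_card_degrees:
  assumes W: "W \<in> vs.subspaces"
  shows "vs.vdim W \<le> card (degrees W)"
proof -
  note WD = vs.subspaceD[OF W]
  have finJ: "finite (degrees W)" using WD(2) by (simp add: degrees_def)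
  let ?r = "\<lambda>f. restrict (cf f) (degrees W)"
  have "inj_on ?r W"
  proof (rule inj_onI)
    fix f g assume fg: "f \<in> W" "g \<in> W" "?r f = ?r g"
    have car: "f \<in> carrier P" "g \<in> carrier P" using fg WD(3) by auto
    show "f = g"
    proof (rule ccontr)
      assume "f \<noteq> g"
      then have nz: "f \<ominus>\<^bsub>P\<^esub> g \<noteq> \<zero>\<^bsub>P\<^esub>" using car by simp
      have h: "f \<ominus>\<^bsub>P\<^esub> g \<in> W" using WD(7) fg by blast
      let ?e = "deg R (f \<ominus>\<^bsub>P\<^esub> g)"
      have "?e \<in> degrees W" using h nz by (auto simp: degrees_def)
      then have "cf f ?e = cf g ?e" using fun_cong[OF fg(3), of ?e] by simp
      then have "cf (f \<ominus>\<^bsub>P\<^esub> g) ?e = \<zero>" using car by (simp add: coeff_minus)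
      then show False using lcoeff_nonzero2[OF _ nz] car by simp
    qed
  qed
  moreover have "?r ` W \<subseteq> degrees W \<rightarrow>\<^sub>E carrier R" using WD(3) by (auto split: if_splits)
  moreover have "finite (degrees W \<rightarrow>\<^sub>E carrier R)" using finJ finite_field by (simp add: finite_PiE)
  ultimately have "card W \<le> card (degrees W \<rightarrow>\<^sub>E carrier R)" by (rule card_inj_on_le)
  then have "vs.q ^ vs.vdim W \<le> vs.q ^ card (degrees W)"
    using finJ by (simp add: vs.card_subspace[OF W] card_funcsetE)
  then show ?thesis using vs.q_ge_2 by (simp add: power_increasing_iff)
qed

definition pairing :: "nat \<Rightarrow> (nat \<Rightarrow> nat \<Rightarrow> 'a) \<Rightarrow> 'a \<Rightarrow> (nat \<Rightarrow> 'a) \<Rightarrow> 'a" where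
  "pairing d B x f = (\<Oplus>t\<in>{..<d}. ev x (B t) \<otimes> ev (\<gamma> [^] t \<otimes> x) f)"

text \<open>Stands in for the non-vanishing of the folded Wronskian: if \<open>\<Sum>t<d. B t (x) f (\<gamma>\<^sup>t x)\<close> vanishes
  for all \<open>f \<in> W\<close>, then the top coefficients of \<open>B\<close> form a polynomial of degree below \<open>d\<close> vanishing at
  \<open>\<gamma>\<^sup>e\<close> for each of the \<open>d\<close> degrees \<open>e\<close> attained in \<open>W\<close>.\<close>

lemma pairing_nondegenerate:
  assumes W: "W \<in> vs.subspaces" and k_ord: "k \<le> ord_\<gamma>"
    and B: "\<And>t. t < vs.vdim W \<Longrightarrow> B t \<in> polys m"
    and A: "A \<subseteq> carrier R" "m + k \<le> card A + 1"
    and zero: "\<And>f x. f \<in> W \<Longrightarrow> x \<in> A \<Longrightarrow> pairing (vs.vdim W) B x f = \<zero>"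
    and t: "t < vs.vdim W"
  shows "B t = \<zero>\<^bsub>P\<^esub>"
proof (rule ccontr)
  assume nz: "B t \<noteq> \<zero>\<^bsub>P\<^esub>"
  define d where "d = vs.vdim W"
  note WD = vs.subspaceD[OF W]
  have Bd: "B t \<in> polys m" if "t < d" for t using B that by (simp add: d_def)
  have Bc: "B t \<in> carrier P" if "t < d" for t using Bd[OF that] by (rule polys_carrier)
  have \<gamma>t: "\<gamma> [^] t \<in> carrier R" for t :: nat using \<gamma> by simp
  have Wk: "f \<in> polys k" if "f \<in> W" for f using WD(1) that by blast
  have dil: "dilate (\<gamma> [^] t) f \<in> polys k" if "f \<in> W" for f and t :: nat
    using dilate_polys[OF Wk[OF that] \<gamma>t] .
  \<comment> \<open>Q f = \<Sum>t. B t(X) f(\<gamma>^t X) is the polynomial whose value at x is the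
    pairing. Its degree is below m + k - 1 \<le> |A|, so vanishing on \<open>A\<close> makes it
    zero.\<close>
  define Q where "Q f = (\<Oplus>\<^bsub>P\<^esub>t\<in>{..<d}. B t \<otimes>\<^bsub>P\<^esub> dilate (\<gamma> [^] t) f)" for f
  have term_closed: "(\<lambda>t. B t \<otimes>\<^bsub>P\<^esub> dilate (\<gamma> [^] t) f) \<in> {..<d} \<rightarrow> carrier P" if "f \<in> W" for f
    using Bc polys_carrier[OF dil[OF that]] by auto
  have Q_coeff: "cf (Q f) j = (\<Oplus>t\<in>{..<d}. cf (B t \<otimes>\<^bsub>P\<^esub> dilate (\<gamma> [^] t) f) j)" if "f \<in> W" for f j
    unfolding Q_def by (rule coeff_finsum) (use term_closed[OF that] in auto)
  have Q_zero: "Q f = \<zero>\<^bsub>P\<^esub>" if f: "f \<in> W" for f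
  proof (rule polys_eq_zeroI[OF _ A(1), of _ "m + k - 1"])
    have "cf (Q f) j = \<zero>" if j: "m + k - 1 \<le> j" for j
    proof -
      have "cf (B t \<otimes>\<^bsub>P\<^esub> dilate (\<gamma> [^] t) f) j = \<zero>" if "t < d" for t
        using polys_coeff[OF mult_polys[OF Bd[OF that] dil[OF f], of "m + k - 1"] j] k_pos by simp
      then show ?thesis unfolding Q_coeff[OF f] by (simp cong: R.finsum_cong)
    qed
    moreover have "Q f \<in> carrier P" unfolding Q_def using term_closed[OF f] by (rule finsum_closed)
    ultimately show "Q f \<in> polys (m + k - 1)" by (simp add: polys_def)
    show "m + k - 1 \<le> card A" using A(2) by simp
    fix x assume x: "x \<in> A"
    then have xc: "x \<in> carrier R" using A by blast
    interpret UP_pre_univ_prop R R id by unfold_locales simp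
    interpret h: ring_hom_cring P R "ev x" by unfold_locales (rule eval_ring_hom[OF xc])
    have "ev x (Q f) = (\<Oplus>t\<in>{..<d}. ev x (B t \<otimes>\<^bsub>P\<^esub> dilate (\<gamma> [^] t) f))"
      unfolding Q_def using h.hom_finsum[OF term_closed[OF f]] by (simp add: comp_def)
    also have "\<dots> = pairing d B x f"
      unfolding pairing_def
      using Bc polys_carrier[OF dil[OF f]] xc \<gamma>t polys_carrier[OF Wk[OF f]]
      by (intro R.finsum_cong')
        (auto simp: evalRR_mult ev_dilate[OF Wk[OF f] \<gamma>t xc] ev_closed)
    also have "\<dots> = \<zero>" using zero[OF f x] by (simp add: d_def)
    finally show "ev x (Q f) = \<zero>" .
  qed
  \<comment> \<open>\<open>E\<close> is the largest exponent occurring in any \<open>B t\<close>,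
    and \<beta> collects the coefficients at \<open>E\<close>. The coefficient of Q f at E + deg f
    is then the leading coefficient of f times \<beta>(\<gamma>^(deg f)).\<close>
  define J where "J = {j. \<exists>t<d. cf (B t) j \<noteq> \<zero>}"
  have J_sub: "J \<subseteq> {..<m}" using Bd polys_coeff by (force simp: J_def not_le[symmetric])
  then have finJ: "finite J" by (rule finite_subset) simp
  have "cf (B t) (deg R (B t)) \<noteq> \<zero>" using lcoeff_nonzero2[OF Bc nz] t by (simp add: d_def)
  then have "J \<noteq> {}" using t by (auto simp: J_def d_def)
  define E where "E = Max J"
  have E: "E \<in> J" using finJ \<open>J \<noteq> {}\<close> by (simp add: E_def)
  have above: "cf (B t) j = \<zero>" if "t < d" "E < j" for t j
    using that Max_ge[OF finJ, of j] by (force simp: J_def E_def)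
  define \<beta> where "\<beta> t = (if t < d then cf (B t) E else \<zero>)" for t
  have \<beta>: "\<beta> \<in> polys d" by (rule polysI(1)) (use Bc in \<open>auto simp: \<beta>_def\<close>)
  have \<beta>_cf: "cf \<beta> t = \<beta> t" for t using cf_apply[OF polys_carrier[OF \<beta>]] .
  have root: "ev (\<gamma> [^] e) \<beta> = \<zero>" if e: "e \<in> degrees W" for e
  proof -
    obtain f where f: "f \<in> W" "f \<noteq> \<zero>\<^bsub>P\<^esub>" "e = deg R f" using e by (auto simp: degrees_def)
    have fc: "f \<in> carrier P" using f WD(3) by blast
    have lead: "cf f e \<in> carrier R" "cf f e \<noteq> \<zero>" using lcoeff_nonzero2[OF fc f(2)] f(3) fc by auto
    have "cf (B t \<otimes>\<^bsub>P\<^esub> dilate (\<gamma> [^] t) f) (E + e) = cf f e \<otimes> (cf \<beta> t \<otimes> (\<gamma> [^] e) [^] t)"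
      if "t < d" for t
    proof -
      have top: "cf (dilate (\<gamma> [^] t) f) j = \<zero>" if "e < j" for j
        using that f(3) fc \<gamma>t[of t] by (simp add: coeff_dilate[OF Wk[OF f(1)] \<gamma>t] deg_aboveD)
      have "(\<gamma> [^] t) [^] e = (\<gamma> [^] e) [^] t" using \<gamma> by (simp add: R.nat_pow_pow mult.commute)
      then show ?thesis
        using coeff_mult_top[OF Bc[OF that] above[OF that] polys_carrier[OF dil[OF f(1)]] top]
          Bc[OF that] lead \<gamma> that
        by (simp add: coeff_dilate[OF Wk[OF f(1)] \<gamma>t] \<beta>_cf \<beta>_def R.m_ac)
    qed
    then have "\<zero> = (\<Oplus>t\<in>{..<d}. cf f e \<otimes> (cf \<beta> t \<otimes> (\<gamma> [^] e) [^] t))"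
      using Q_coeff[OF f(1), of "E + e"] Q_zero[OF f(1)] lead polys_carrier[OF \<beta>] \<gamma>
      by (simp cong: R.finsum_cong)
    also have "\<dots> = cf f e \<otimes> ev (\<gamma> [^] e) \<beta>"
      using lead polys_carrier[OF \<beta>] \<gamma> by (simp add: ev_polys[OF \<beta>] R.finsum_rdistr)
    finally show ?thesis
      using lead ev_closed[OF \<gamma>t polys_carrier[OF \<beta>]] by (metis R.integral)
  qed
  \<comment> \<open>Degrees are below k \<le> ord \<gamma>, so distinct degrees give distinct roots
    of \<beta>: at least \<open>d\<close> of them, against a degree below \<open>d\<close>.\<close>
  have "degrees W \<subseteq> {..<ord_\<gamma>}"
  proof
    fix e assume "e \<in> degrees W"
    then obtain f where "f \<in> W" "f \<noteq> \<zero>\<^bsub>P\<^esub>" "e = deg R f" by (auto simp: degrees_def)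
    then show "e \<in> {..<ord_\<gamma>}" using deg_polys[OF Wk] k_ord by fastforce
  qed
  then have "inj_on (\<lambda>e. \<gamma> [^] e) (degrees W)" by (rule inj_on_subset[OF pow_inj])
  then have "d \<le> card ((\<lambda>e. \<gamma> [^] e) ` degrees W)"
    using vdim_le_card_degrees[OF W] by (simp add: card_image d_def)
  then have "\<beta> = \<zero>\<^bsub>P\<^esub>"
    using root \<gamma>t by (intro polys_eq_zeroI[OF \<beta>, of "(\<lambda>e. \<gamma> [^] e) ` degrees W"]) auto
  then have "cf \<beta> t = \<zero>" for t by simp
  moreover have "cf (B t) E = cf \<beta> t" if "t < d" for t unfolding \<beta>_cf using that by (simp add: \<beta>_def)
  ultimately have "cf (B t) E = \<zero>" if "t < d" for t using that by simp
  then show False using E by (auto simp: J_def)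
qed

lemma pairing_closed:
  "(\<And>t. t < d \<Longrightarrow> B t \<in> carrier P) \<Longrightarrow> x \<in> carrier R \<Longrightarrow> f \<in> carrier P \<Longrightarrow> pairing d B x f \<in> carrier R"
  unfolding pairing_def using \<gamma> by (intro R.finsum_closed) (auto intro!: ev_closed R.m_closed)

text \<open>This allows the vanishing of the pairing on \<open>W\<close> to be tested on
  \<open>W \<inter> H i\<close> and a spanning complement.\<close>

lemma pairing_kernel_subspace:
  assumes B: "\<And>t. t < d \<Longrightarrow> B t \<in> carrier P" and x: "x \<in> carrier R"
  shows "{f \<in> polys k. pairing d B x f = \<zero>} \<in> vs.subspaces"
proof (rule vs.subspaceI)
  have xt: "\<gamma> [^] t \<otimes> x \<in> carrier R" for t :: nat using \<gamma> x by simp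
  have bc: "ev x (B t) \<in> carrier R" if "t < d" for t using B[OF that] x by (intro ev_closed)
  show "\<zero>\<^bsub>P\<^esub> \<in> {f \<in> polys k. pairing d B x f = \<zero>}"
    using bc by (simp add: zero_polys pairing_def ev_zero[OF xt] cong: R.finsum_cong)
  fix f g assume fg: "f \<in> {f \<in> polys k. pairing d B x f = \<zero>}" "g \<in> {f \<in> polys k. pairing d B x f = \<zero>}"
  then have c: "f \<in> carrier P" "g \<in> carrier P" by (auto simp: polys_carrier)
  have "pairing d B x (f \<oplus>\<^bsub>P\<^esub> g) = (\<Oplus>t\<in>{..<d}. ev x (B t) \<otimes> ev (\<gamma> [^] t \<otimes> x) f
      \<oplus> ev x (B t) \<otimes> ev (\<gamma> [^] t \<otimes> x) g)"
    unfolding pairing_def using c bc ev_closed[OF xt]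
    by (intro R.finsum_cong') (auto simp: evalRR_add[OF _ _ xt] R.r_distr)
  also have "\<dots> = pairing d B x f \<oplus> pairing d B x g"
    unfolding pairing_def using c bc ev_closed[OF xt] by (intro R.finsum_addf) auto
  finally show "f \<oplus>\<^bsub>P\<^esub> g \<in> {f \<in> polys k. pairing d B x f = \<zero>}"
    using fg by (simp add: add_polys)
next
  have xt: "\<gamma> [^] t \<otimes> x \<in> carrier R" for t :: nat using \<gamma> x by simp
  have bc: "ev x (B t) \<in> carrier R" if "t < d" for t using B[OF that] x by (intro ev_closed)
  fix a f assume a: "a \<in> carrier R" and f: "f \<in> {f \<in> polys k. pairing d B x f = \<zero>}"
  then have c: "f \<in> carrier P" by (auto simp: polys_carrier)
  have "pairing d B x (a \<odot>\<^bsub>P\<^esub> f) = (\<Oplus>t\<in>{..<d}. a \<otimes> (ev x (B t) \<otimes> ev (\<gamma> [^] t \<otimes> x) f))"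
    unfolding pairing_def using c a bc ev_closed[OF xt]
    by (intro R.finsum_cong') (auto simp: ev_smult[OF _ xt] R.m_ac)
  also have "\<dots> = a \<otimes> pairing d B x f"
    unfolding pairing_def using c a bc ev_closed[OF xt] by (intro R.finsum_rdistr[symmetric]) auto
  finally show "a \<odot>\<^bsub>P\<^esub> f \<in> {f \<in> polys k. pairing d B x f = \<zero>}"
    using f a by (simp add: smult_polys)
qed auto

lemma pairing_diff:
  assumes B: "\<And>t. t < d \<Longrightarrow> B t \<in> carrier P" and C: "\<And>t. t < d \<Longrightarrow> C t \<in> carrier P"
    and x: "x \<in> carrier R" and f: "f \<in> carrier P"
    and eq: "pairing d B x f = pairing d C x f"
  shows "pairing d (\<lambda>t. B t \<ominus>\<^bsub>P\<^esub> C t) x f = \<zero>"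
proof -
  have xt: "\<gamma> [^] t \<otimes> x \<in> carrier R" for t :: nat using \<gamma> x by simp
  have c: "ev x (B t) \<in> carrier R" "ev x (C t) \<in> carrier R" "B t \<ominus>\<^bsub>P\<^esub> C t \<in> carrier P"
    "ev x (B t \<ominus>\<^bsub>P\<^esub> C t) = ev x (B t) \<ominus> ev x (C t)" if "t < d" for t
    using B[OF that] C[OF that] x by (auto intro: ev_closed simp: evalRR_sub)
  have ft: "ev (\<gamma> [^] t \<otimes> x) f \<in> carrier R" for t :: nat using ev_closed[OF xt f] .
  have "pairing d (\<lambda>t. B t \<ominus>\<^bsub>P\<^esub> C t) x f \<oplus> pairing d C x f
    = (\<Oplus>t\<in>{..<d}. ev x (B t \<ominus>\<^bsub>P\<^esub> C t) \<otimes> ev (\<gamma> [^] t \<otimes> x) f \<oplus> ev x (C t) \<otimes> ev (\<gamma> [^] t \<otimes> x) f)"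
    unfolding pairing_def using c ft by (intro R.finsum_addf[symmetric]) auto
  also have "\<dots> = pairing d B x f"
    unfolding pairing_def using c ft
    by (intro R.finsum_cong') (auto simp: R.l_distr[symmetric] a_minus_def R.a_assoc R.l_neg)
  finally show ?thesis
    using eq pairing_closed[of d C x f] pairing_closed[of d "\<lambda>t. B t \<ominus>\<^bsub>P\<^esub> C t" x f] c(3) C x f
    by simp
qed

text \<open>Tuples \<open>B\<close> of polynomials inject into families of linear functionals on \<open>W\<close>, one for each
  evaluation point, given by the pairing. At the points of block \<open>i\<close> these functionals vanish on \<open>W \<inter> H i\<close>;
  comparing cardinalities gives the inequality. If \<open>\<gamma>\<close> has order below \<open>s\<close> the points are not distinct,
  but then one symbol already determines the message.\<close>

theorem folded_subspace_design:
  assumes W: "W \<in> vs.subspaces" and d_le: "vs.vdim W \<le> s" and k_ord: "k \<le> ord_\<gamma>"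
  shows "(s - vs.vdim W + 1) * (\<Sum>i<n. vs.vdim (W \<inter> H i)) \<le> vs.vdim W * (k - 1)"
proof -
  define d where "d = vs.vdim W"
  \<comment> \<open>The number of windows of \<open>d\<close> consecutive points in a block of
    \<open>s\<close>.\<close>
  define r where "r = s - d + 1"
  define D where "D i = vs.vdim (W \<inter> H i)" for i
  note WD = vs.subspaceD[OF W]
  have WH: "W \<inter> H i \<in> vs.subspaces" if "i < n" for i
    using vs.inter_subspace[OF W H_subspace[OF that]] .
  have D_le: "D i \<le> d" if "i < n" for i
    unfolding D_def d_def using WH[OF that] W by (intro vs.dim_mono) auto
  \<comment> \<open>When r n < k the bound follows from D i \<le> d alone. Counting is reserved for
    k \<le> r n, where \<open>m\<close> below is positive.\<close>
  consider "d = 0" | "0 < d" "ord_\<gamma> < s" | "0 < d" "s \<le> ord_\<gamma>" "r * n < k"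
    | "0 < d" "s \<le> ord_\<gamma>" "k \<le> r * n" by linarith
  then have "r * (\<Sum>i<n. D i) \<le> d * (k - 1)"
  proof cases
    case 1
    then have "(\<Sum>i<n. D i) = 0" using D_le by simp
    then show ?thesis by simp
  next
    case 2
    have "D i = 0" if i: "i < n" for i
    proof -
      have "f = \<zero>\<^bsub>P\<^esub>" if f: "f \<in> H i" for f
      proof (rule polys_eq_zeroI[of f k "point i ` {..<k}"])
        show "f \<in> polys k" using f by (simp add: H_def)
        show "point i ` {..<k} \<subseteq> carrier R" using i point_closed by auto
        have "inj_on (point i) {..<k}"
          using point_inj[of k] 2 k_ord i by (auto simp: inj_on_def)
        then show "k \<le> card (point i ` {..<k})" by (simp add: card_image)
        show "ev x f = \<zero>" if "x \<in> point i ` {..<k}" for x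
          using that f 2 k_ord by (auto simp: H_def)
      qed
      then have "W \<inter> H i = {\<zero>\<^bsub>P\<^esub>}" using vs.subspaceD(4)[OF WH[OF i]] by auto
      then show ?thesis by (simp add: D_def vs.vdim_zero)
    qed
    then show ?thesis by simp
  next
    case 3
    have "r * (\<Sum>i<n. D i) \<le> r * (\<Sum>i<n. d)" using D_le by (intro mult_left_mono sum_mono) auto
    also have "\<dots> = d * (r * n)" by simp
    also have "\<dots> \<le> d * (k - 1)" using 3 by (intro mult_left_mono) auto
    finally show ?thesis .
  next
    case 4
    define p where "p = r * n"
    \<comment> \<open>The largest \<open>m\<close> that \<open>pairing_nondegenerate\<close> admits
      for p points, namely m + k = p + 1.\<close>
    define m where "m = p + 1 - k"
    have r_le: "r \<le> s" using 4 d_le by (simp add: r_def d_def)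
    define I where "I = {..<n} \<times> {..<r}"
    have finI: "finite I" by (simp add: I_def)
    define x where "x = (\<lambda>(i, u). point i u)"
    have x_inj: "inj_on x I" unfolding x_def I_def using point_inj[of r] r_le 4 by simp
    have x_closed: "x \<iota> \<in> carrier R" if "\<iota> \<in> I" for \<iota>
      using that point_closed by (auto simp: x_def I_def)
    have card_x: "card (x ` I) = p" using card_image[OF x_inj] by (simp add: I_def p_def mult.commute)
    have "\<forall>i\<in>{..<n}. \<exists>T. T \<subseteq> W \<and> card T + D i \<le> d \<and>
        (\<forall>Z\<in>vs.subspaces. W \<inter> H i \<subseteq> Z \<longrightarrow> T \<subseteq> Z \<longrightarrow> W \<subseteq> Z)"
    proof
      fix i assume "i \<in> {..<n}"
      then have "W \<inter> H i \<in> vs.subspaces" using WH by simp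
      from vs.spanning_complement[OF this W]
      show "\<exists>T. T \<subseteq> W \<and> card T + D i \<le> d \<and>
        (\<forall>Z\<in>vs.subspaces. W \<inter> H i \<subseteq> Z \<longrightarrow> T \<subseteq> Z \<longrightarrow> W \<subseteq> Z)"
        unfolding D_def d_def by (metis inf_le1)
    qed
    then obtain T where T: "\<And>i. i < n \<Longrightarrow> T i \<subseteq> W" "\<And>i. i < n \<Longrightarrow> card (T i) + D i \<le> d"
      "\<And>i Z. i < n \<Longrightarrow> Z \<in> vs.subspaces \<Longrightarrow> W \<inter> H i \<subseteq> Z \<Longrightarrow> T i \<subseteq> Z \<Longrightarrow> W \<subseteq> Z"
      by (metis lessThan_iff)
    have finT: "finite (T i)" if "i < n" for i using T(1)[OF that] WD(2) finite_subset by blast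
    \<comment> \<open>For each window start, a functional on \<open>W\<close> vanishing on
      \<open>W \<inter> H i\<close> is recorded by its values on \<open>T i\<close>, which has at
      most d - D i elements.\<close>
    define \<Phi> where "\<Phi> B = (\<lambda>\<iota>\<in>I. \<lambda>f\<in>T (fst \<iota>). pairing d B (x \<iota>) f)" for B
    define Dom where "Dom = {..<d} \<rightarrow>\<^sub>E polys m"
    define Cod where "Cod = (\<Pi>\<^sub>E \<iota>\<in>I. T (fst \<iota>) \<rightarrow>\<^sub>E carrier R)"
    have car: "B t \<in> carrier P" if "B \<in> Dom" "t < d" for B t
      using PiE_mem[of B "{..<d}" "\<lambda>_. polys m" t] that by (simp add: Dom_def polys_carrier)
    have Wc: "f \<in> carrier P" if "f \<in> W" for f using WD(3) that by blast
    have "\<Phi> ` Dom \<subseteq> Cod"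
    proof
      fix y assume "y \<in> \<Phi> ` Dom"
      then obtain B where B: "B \<in> Dom" "y = \<Phi> B" by blast
      have "pairing d B (x \<iota>) f \<in> carrier R" if "\<iota> \<in> I" "f \<in> T (fst \<iota>)" for \<iota> f
      proof -
        have "f \<in> W" using T(1)[of "fst \<iota>"] that by (auto simp: I_def)
        then show ?thesis using car[OF B(1)] x_closed[OF that(1)] Wc by (intro pairing_closed)
      qed
      then show "y \<in> Cod" unfolding B(2) \<Phi>_def Cod_def by (intro restrict_PiE_iff[THEN iffD2] ballI) auto
    qed
    moreover have "inj_on \<Phi> Dom"
    proof (rule inj_onI)
      fix B C assume B: "B \<in> Dom" and C: "C \<in> Dom" and eq: "\<Phi> B = \<Phi> C"
      define E where "E t = B t \<ominus>\<^bsub>P\<^esub> C t" for t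
      have Em: "E t \<in> polys m" if "t < d" for t
      proof -
        have "B t \<in> polys m" "C t \<in> polys m"
          using PiE_mem[OF B[unfolded Dom_def]] PiE_mem[OF C[unfolded Dom_def]] that by auto
        then show ?thesis unfolding E_def by (rule minus_polys)
      qed
      have Ec: "E t \<in> carrier P" if "t < d" for t using Em[OF that] by (rule polys_carrier)
      have "pairing d E z f = \<zero>" if f: "f \<in> W" and z: "z \<in> x ` I" for f z
      proof -
        obtain i u where iu: "i < n" "u < r" "z = point i u" using z by (auto simp: I_def x_def)
        have zc: "z \<in> carrier R" using iu point_closed by simp
        have I: "(i, u) \<in> I" "x (i, u) = z" using iu by (auto simp: I_def x_def)
        let ?Z = "{f \<in> polys k. pairing d E z f = \<zero>}"
        have "W \<subseteq> ?Z"
        proof (rule T(3)[OF iu(1)])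
          show "?Z \<in> vs.subspaces" by (rule pairing_kernel_subspace[OF Ec zc])
          show "T i \<subseteq> ?Z"
          proof
            fix f assume f: "f \<in> T i"
            then have fW: "f \<in> W" using T(1)[OF iu(1)] by blast
            have "\<Phi> B (i, u) f = \<Phi> C (i, u) f" using eq by simp
            then have "pairing d B z f = pairing d C z f" using f I by (simp add: \<Phi>_def)
            then have "pairing d E z f = \<zero>"
              unfolding E_def by (rule pairing_diff[OF _ _ zc Wc[OF fW], rotated 2]) (rule car[OF B] car[OF C], assumption)+
            then show "f \<in> ?Z" using fW WD(1) by blast
          qed
          show "W \<inter> H i \<subseteq> ?Z"
          proof
            fix f assume f: "f \<in> W \<inter> H i"
            have "ev (\<gamma> [^] t \<otimes> z) f = \<zero>" if t: "t < d" for t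
            proof -
              have "\<gamma> [^] t \<otimes> z = point i (u + t)"
                using \<alpha>[OF iu(1)] \<gamma> unfolding iu(3) point_def
                by (simp add: R.nat_pow_mult[symmetric] R.m_ac)
              \<comment> \<open>A window starting at u < s - d + 1 ends at u + d - 1 < s, inside its
                block.\<close>
              moreover have "u + t < s" using iu(2) t d_le by (simp add: r_def d_def)
              ultimately show ?thesis using f by (simp add: H_def)
            qed
            then have "pairing d E z f = \<zero>"
              using ev_closed[OF zc Ec] unfolding pairing_def by (simp cong: R.finsum_cong)
            then show "f \<in> ?Z" using f WD(1) by blast
          qed
        qed
        then show ?thesis using f by blast
      qed
      moreover have "x ` I \<subseteq> carrier R" using x_closed by (rule image_subsetI)
      ultimately have E0: "E t = \<zero>\<^bsub>P\<^esub>" if "t < d" for t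
        using pairing_nondegenerate[OF W k_ord, of E m "x ` I" t] Em card_x that 4
        unfolding d_def[symmetric] by (auto simp: m_def p_def)
      show "B = C"
      proof (rule PiE_ext)
        show "B \<in> {..<d} \<rightarrow>\<^sub>E polys m" "C \<in> {..<d} \<rightarrow>\<^sub>E polys m" using B C by (auto simp: Dom_def)
        fix t assume "t \<in> {..<d}"
        then show "B t = C t" using E0[of t] car[OF B] car[OF C] by (simp add: E_def)
      qed
    qed
    moreover have "finite Cod"
      unfolding Cod_def using finI finT finite_field
      by (intro finite_PiE) (auto simp: I_def intro!: finite_PiE)
    ultimately have "card Dom \<le> card Cod" by (intro card_inj_on_le)
    moreover have "card Dom = vs.q ^ (m * d)"
      by (simp add: Dom_def card_funcsetE card_polys power_mult)
    moreover have "card Cod = vs.q ^ (\<Sum>\<iota>\<in>I. card (T (fst \<iota>)))"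
    proof -
      have "card Cod = (\<Prod>\<iota>\<in>I. card (T (fst \<iota>) \<rightarrow>\<^sub>E carrier R))"
        unfolding Cod_def by (rule card_PiE[OF finI])
      also have "\<dots> = (\<Prod>\<iota>\<in>I. vs.q ^ card (T (fst \<iota>)))"
        using finT by (intro prod.cong refl card_funcsetE) (auto simp: I_def)
      finally show ?thesis by (simp add: power_sum)
    qed
    \<comment> \<open>Exponents of |Dom| \<le> |Cod|. Adding r \<Sum>i. D i to both sides eliminates
      the sizes of the \<open>T i\<close>.\<close>
    ultimately have "m * d \<le> (\<Sum>\<iota>\<in>I. card (T (fst \<iota>)))"
      using vs.q_ge_2 by (simp add: power_increasing_iff)
    also have "\<dots> = r * (\<Sum>i<n. card (T i))"
      using sum.cartesian_product[of "\<lambda>i u. card (T i)" "{..<r}" "{..<n}"]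
      by (simp add: I_def case_prod_unfold sum_distrib_left)
    finally have "m * d + r * (\<Sum>i<n. D i) \<le> r * (\<Sum>i<n. card (T i) + D i)"
      by (simp add: sum.distrib distrib_left)
    also have "\<dots> \<le> r * (\<Sum>i<n. d)" using T(2) by (intro mult_left_mono sum_mono) auto
    also have "\<dots> = p * d" by (simp add: p_def)
    also have "\<dots> = (m + (k - 1)) * d"
      using 4(3) k_pos by (simp add: m_def p_def)
    also have "\<dots> = m * d + d * (k - 1)" by (simp add: algebra_simps)
    finally show ?thesis by simp
  qed
  then show ?thesis by (simp add: r_def d_def D_def)
qed

end

subsection \<open>Rate and list size of folded Reed-Solomon codes\<close>

context folded_code
begin

section \<open>Coefficient lists and the rate of the code\<close>

lemma coeff_list_polys:
  assumes "set p \<subseteq> carrier R"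
  shows "ring.coeff R p \<in> polys (length p)"
  using assms by (intro polysI(1)) (auto simp: R.coeff_length)

lemma eval_list_eq_ev:
  assumes "set p \<subseteq> carrier R" "x \<in> carrier R"
  shows "ring.eval R p x = ev x (ring.coeff R p)"
proof -
  have "ring.eval R p x = (\<Oplus>j\<in>{..<length p}. ring.coeff R p j \<otimes> x [^] j)"
    using assms
  proof (induction p)
    case (Cons a p)
    have "(\<Oplus>j\<in>{..<length p}. ring.coeff R (a # p) j \<otimes> x [^] j)
      = (\<Oplus>j\<in>{..<length p}. ring.coeff R p j \<otimes> x [^] j)"
      using Cons.prems by (intro R.finsum_cong') auto
    then show ?case using Cons by (simp add: lessThan_Suc)
  qed simp
  then show ?thesis
    using ev_polys[OF coeff_list_polys[OF assms(1)] assms(2)]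
      cf_apply[OF polys_carrier[OF coeff_list_polys[OF assms(1)]]] by simp
qed

lemma list_of_polys:
  assumes f: "f \<in> polys m"
  obtains p where "p \<in> carrier (univ_poly R (carrier R))" "length p \<le> m" "ring.coeff R p = f"
proof -
  \<comment> \<open>Coefficient lists run from the top coefficient down, hence the reversal;
    \<open>normalize\<close> strips the leading zeros.\<close>
  define l where "l = map f (rev [0..<m])"
  have fv: "f j \<in> carrier R" "m \<le> j \<Longrightarrow> f j = \<zero>" for j
    using f cf_apply[OF polys_carrier[OF f], of j] by (auto simp: polys_def carrier_iff)
  have l: "set l \<subseteq> carrier R" "length l = m" using fv by (auto simp: l_def)
  have "ring.coeff R l j = f j" for j
  proof (cases "j < m")
    case True
    then have "ring.coeff R l j = l ! (m - 1 - j)" using R.coeff_nth[of j l] l by simp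
    then show ?thesis using True by (simp add: l_def rev_map[symmetric] rev_nth)
  next
    case False
    then show ?thesis using l fv R.coeff_length[of l j] by simp
  qed
  then have "ring.coeff R (ring.normalize R l) = f" using R.normalize_coeff[of l] by (auto simp: fun_eq_iff)
  moreover have "ring.normalize R l \<in> carrier (univ_poly R (carrier R))"
    using R.normalize_gives_polynomial[OF l(1)] by (simp add: univ_poly_carrier[symmetric])
  moreover have "length (ring.normalize R l) \<le> m" using R.normalize_length_le[of l] l by simp
  ultimately show ?thesis using that by blast
qed

definition encode :: "(nat \<Rightarrow> 'a) \<Rightarrow> nat \<Rightarrow> nat \<Rightarrow> 'a" where
  "encode f = (\<lambda>i\<in>{..<n}. symbol i f)"

lemma folded_rs_eq: "folded_rs R n k s \<gamma> \<alpha> = encode ` polys k"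
proof -
  have enc: "(\<lambda>i\<in>{..<n}. \<lambda>t\<in>{..<s}. ring.eval R p (\<alpha> i \<otimes> \<gamma> [^] t)) = encode (ring.coeff R p)"
    if "set p \<subseteq> carrier R" for p
    using eval_list_eq_ev[OF that point_closed]
    by (auto simp: encode_def symbol_def point_def restrict_def fun_eq_iff)
  have set_p: "set p \<subseteq> carrier R" if "p \<in> carrier (univ_poly R (carrier R))" for p
    using that by (auto simp: univ_poly_carrier[symmetric] polynomial_def)
  show ?thesis
  proof (intro subset_antisym subsetI)
    fix c assume "c \<in> folded_rs R n k s \<gamma> \<alpha>"
    then obtain p where p: "p \<in> carrier (univ_poly R (carrier R))" "degree p < k"
      "c = encode (ring.coeff R p)"
      using enc set_p by (auto simp: folded_rs_def)
    \<comment> \<open>On lists \<open>degree\<close> is length - 1 truncated at 0, so positivity of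
      \<open>k\<close> turns degree < k into length \<le> k, also for the empty list.\<close>
    have "ring.coeff R p \<in> polys k"
      using coeff_list_polys[OF set_p[OF p(1)]] p(2) k_pos by (auto simp: polys_def)
    then show "c \<in> encode ` polys k" using p(3) by blast
  next
    fix c assume "c \<in> encode ` polys k"
    then obtain f where f: "f \<in> polys k" "c = encode f" by blast
    obtain p where p: "p \<in> carrier (univ_poly R (carrier R))" "length p \<le> k" "ring.coeff R p = f"
      using list_of_polys[OF f(1)] .
    then have "degree p < k" using k_pos by simp
    then show "c \<in> folded_rs R n k s \<gamma> \<alpha>"
      unfolding folded_rs_def using p f(2) enc[OF set_p[OF p(1)]] by (intro image_eqI[of _ _ p]) auto
  qed
qed

text \<open>A message of degree below N = min k (s n) is determined by its values at n min(s, ord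
  \<gamma>) distinct points. Cutting down to \<open>N\<close> covers k > s n, where encoding all of
  \<open>polys k\<close> is not injective.\<close>

lemma card_folded_rs_ge: "vs.q ^ min k (s * n) \<le> card (folded_rs R n k s \<gamma> \<alpha>)"
proof -
  define m where "m = min s ord_\<gamma>"
  define N where "N = min k (s * n)"
  define A where "A = (\<lambda>(i, t). point i t) ` ({..<n} \<times> {..<m})"
  have "card A = n * m"
    unfolding A_def using card_image[OF point_inj[of m]] by (simp add: m_def)
  moreover have "N \<le> n * m"
  proof (cases "s \<le> ord_\<gamma>")
    case False
    \<comment> \<open>If ord \<gamma> < s, a single block already supplies enough distinct
      points.\<close>
    have "N \<le> ord_\<gamma>" using min_le_ord by (simp add: N_def)
    also have "\<dots> \<le> n * ord_\<gamma>" using n_pos by simp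
    finally show ?thesis using False by (simp add: m_def)
  qed (simp add: N_def m_def mult.commute)
  ultimately have A: "N \<le> card A" by simp
  have "inj_on encode (polys N)"
  proof (rule inj_onI)
    fix f g assume fg: "f \<in> polys N" "g \<in> polys N" "encode f = encode g"
    have "f \<ominus>\<^bsub>P\<^esub> g = \<zero>\<^bsub>P\<^esub>"
    proof (rule polys_eq_zeroI[OF minus_polys[OF fg(1,2)] _ A])
      show "A \<subseteq> carrier R" using point_closed by (auto simp: A_def)
      fix x assume "x \<in> A"
      then obtain i t where it: "i < n" "t < m" "x = point i t" by (auto simp: A_def)
      have "symbol i f t = symbol i g t" using fun_cong[OF fg(3), of i] it by (simp add: encode_def)
      then have "ev x f = ev x g" using it by (simp add: symbol_def m_def)
      then show "ev x (f \<ominus>\<^bsub>P\<^esub> g) = \<zero>"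
        using fg(1,2) it point_closed[OF it(1)] by (simp add: evalRR_sub polys_carrier ev_closed)
    qed
    then show "f = g" using fg(1,2) by (simp add: polys_carrier)
  qed
  then have "card (polys N) = card (encode ` polys N)" by (simp add: card_image)
  also have "\<dots> \<le> card (encode ` polys k)"
    by (intro card_mono finite_imageI finite_polys image_mono) (auto simp: polys_def N_def)
  finally show ?thesis by (simp add: card_polys folded_rs_eq N_def)
qed

text \<open>The theorem speaks of the true rate of the code, and this is the inequality through
  which it controls \<open>k\<close>. The alphabet has q^s elements, whence the factor
  \<open>s\<close>.\<close>

lemma code_rate_ge:
  "real (min k (s * n)) / real (s * n)
    \<le> code_rate (words s (carrier R)) n (folded_rs R n k s \<gamma> \<alpha>)"
proof -
  let ?Q = "real (vs.q ^ s)"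
  let ?m = "min k (s * n)"
  have q1: "1 < real vs.q" using vs.q_ge_2 by simp
  then have Q1: "1 < ?Q" using s_pos by simp
  have "real ?m / real s = log ?Q (real (vs.q ^ ?m))"
    using q1 s_pos by (simp add: log_nat_power log_base_pow)
  also have "\<dots> \<le> log ?Q (real (card (folded_rs R n k s \<gamma> \<alpha>)))"
  proof (rule log_mono[OF Q1])
    show "0 < real (vs.q ^ ?m)" using q1 by simp
    show "real (vs.q ^ ?m) \<le> real (card (folded_rs R n k s \<gamma> \<alpha>))"
      using card_folded_rs_ge by (rule of_nat_mono)
  qed
  also have "?Q = real (card (words s (carrier R)))" by (simp add: words_def card_funcsetE)
  finally have "real ?m / real s / real n
    \<le> log (real (card (words s (carrier R)))) (real (card (folded_rs R n k s \<gamma> \<alpha>))) / real n"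
    by (intro divide_right_mono) auto
  then show ?thesis by (simp add: code_rate_def)
qed

text \<open>To make \<tau> uniform over all dimensions up to \<open>D\<close>, s - vdim U + 1 is
  replaced by its smallest value s - D + 1, and k - 1 is relaxed to k.\<close>

lemma subspace_design_folded:
  assumes D: "D \<le> s" and k_ord: "k \<le> ord_\<gamma>"
  shows "subspace_design R P (polys k) n H symbol D (real k / (real n * real (s - D + 1)))"
proof unfold_locales
  fix U assume U: "U \<in> vs.subspaces" "vs.vdim U \<le> D"
  have "(s - D + 1) * (\<Sum>i<n. vs.vdim (U \<inter> H i)) \<le> (s - vs.vdim U + 1) * (\<Sum>i<n. vs.vdim (U \<inter> H i))"
    using U(2) by (intro mult_right_mono) auto
  also have "\<dots> \<le> vs.vdim U * (k - 1)"
    using U D by (intro folded_subspace_design k_ord) auto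
  also have "\<dots> \<le> k * vs.vdim U" by (simp add: mult.commute)
  finally have "real ((s - D + 1) * (\<Sum>i<n. vs.vdim (U \<inter> H i))) \<le> real (k * vs.vdim U)"
    by (rule of_nat_mono)
  then have "real (s - D + 1) * (\<Sum>i<n. real (vs.vdim (U \<inter> H i))) \<le> real k * real (vs.vdim U)"
    by (simp only: of_nat_mult of_nat_sum)
  moreover have "S \<le> real k / (real n * w) * real n * v"
    if "w * S \<le> real k * v" "0 < w" for S w v :: real
  proof -
    have "real k / (real n * w) * real n * v = real k * v / w"
      using n_pos by simp
    then show ?thesis using that by (simp add: pos_le_divide_eq mult.commute)
  qed
  ultimately show "(\<Sum>i<n. real (vs.vdim (U \<inter> H i)))
    \<le> real k / (real n * real (s - D + 1)) * real n * real (vs.vdim U)" by simp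
qed (use n_pos k_pos in \<open>simp_all add: H_subspace symbol_eq_iff\<close>)

end

text \<open>Since 16 = 14 (8/7), the bounds on \<open>D\<close> and \<open>s\<close> give 14 \<rho>
  (D - 1) \<le> s \<epsilon>. Thus windows of length \<open>D\<close> cost at most a fraction
  \<epsilon> / (14 \<rho>) of the folding parameter, which keeps \<tau> \<le> R + \<epsilon> /
  8.\<close>

lemma design_gap:
  fixes k n s D l :: nat and R \<epsilon> :: real
  assumes pos: "0 < n" "0 < s" "0 < l" "0 < R" "0 < \<epsilon>" and le1: "R + \<epsilon> \<le> 1"
    and rate: "real k / real (s * n) \<le> R"
    and s: "16 * (R + \<epsilon>) * real l / \<epsilon>\<^sup>2 < real s"
    and D: "real D - 1 \<le> 8 * real l / (7 * \<epsilon>)"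
  shows "D \<le> s" "7 / 8 * \<epsilon> \<le> R + \<epsilon> - real k / (real n * real (s - D + 1))"
proof -
  define \<rho> where "\<rho> = R + \<epsilon>"
  have \<rho>: "0 < \<rho>" "\<epsilon> < \<rho>" "\<rho> \<le> 1" using pos le1 by (auto simp: \<rho>_def)
  have s': "16 * \<rho> * real l < real s * \<epsilon>\<^sup>2" using s pos by (simp add: \<rho>_def divide_less_eq)
  have "(real D - 1) * (14 * \<rho>) \<le> 8 * real l / (7 * \<epsilon>) * (14 * \<rho>)"
    using D \<rho> by (intro mult_right_mono) auto
  also have "\<dots> = 16 * \<rho> * real l / \<epsilon>" using pos by (simp add: field_simps)
  also have "\<dots> \<le> real s * \<epsilon>" using s' pos by (simp add: divide_le_eq power2_eq_square mult.assoc)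
  finally have D1: "(real D - 1) * (14 * \<rho>) \<le> real s * \<epsilon>" .
  have "real s * \<epsilon> \<le> real s * \<rho>" using \<rho> by (intro mult_left_mono) auto
  with D1 have "((real D - 1) * 14) * \<rho> \<le> real s * \<rho>" by (simp only: mult.assoc)
  then have "(real D - 1) * 14 \<le> real s" using \<rho>(1) by (rule mult_right_le_imp_le)
  then have "14 * real D \<le> real s + 14" by (simp add: algebra_simps)
  moreover have "0 < real s" using pos by simp
  ultimately have "real D < real s + 1" by linarith
  then show Ds: "D \<le> s" by linarith
  define w where "w = real (s - D + 1)"
  have w: "w = real s - (real D - 1)" using Ds by (simp add: w_def)
  have w_pos: "0 < w" by (simp add: w_def)
  have k_le: "real k \<le> R * (real s * real n)" using rate pos by (simp add: divide_le_eq)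
  have "real s * (14 * \<rho> - \<epsilon>) \<le> w * (14 * \<rho>)" using D1 by (simp add: w algebra_simps)
  then have "(R + \<epsilon> / 8) * (real s * (14 * \<rho> - \<epsilon>)) \<le> (R + \<epsilon> / 8) * (w * (14 * \<rho>))"
    using pos by (intro mult_left_mono) auto
  moreover have "R * real s * (14 * \<rho>) \<le> (R + \<epsilon> / 8) * (real s * (14 * \<rho> - \<epsilon>))"
  proof -
    \<comment> \<open>The difference of the two sides of the claim after substituting \<rho> = R +
      \<epsilon>.\<close>
    have "0 \<le> real s * (3 / 4 * \<epsilon> * R + 13 / 8 * \<epsilon>\<^sup>2)" using pos by simp
    then show ?thesis by (simp add: \<rho>_def algebra_simps power2_eq_square)
  qed
  ultimately have "(R * real s) * (14 * \<rho>) \<le> ((R + \<epsilon> / 8) * w) * (14 * \<rho>)" by (simp add: mult.assoc)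
  then have "R * real s \<le> (R + \<epsilon> / 8) * w" using \<rho> by (simp add: mult_le_cancel_right)
  then have "real n * (R * real s) \<le> real n * ((R + \<epsilon> / 8) * w)" by (intro mult_left_mono) auto
  then have "real k \<le> (R + \<epsilon> / 8) * (real n * w)" using k_le by (simp add: algebra_simps)
  then have "real k / (real n * w) \<le> R + \<epsilon> / 8" using pos w_pos by (simp add: divide_le_eq)
  then show "7 / 8 * \<epsilon> \<le> R + \<epsilon> - real k / (real n * real (s - D + 1))" by (simp add: w_def)
qed

text \<open>(1 - \<rho>) / g and d are both at most 8 / (7 \<epsilon>), so N \<le> 1 + (64/49) /
  \<epsilon>^2, and 1 \<le> 1 / \<epsilon>^2.\<close>

lemma unique_list_size:
  fixes N :: nat and \<rho> \<epsilon> g d :: real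
  assumes "0 < \<epsilon>" "\<epsilon> \<le> \<rho>" "\<rho> \<le> 1" "7 / 8 * \<epsilon> \<le> g" "0 \<le> d" "d \<le> 8 / (7 * \<epsilon>)"
    and "real N \<le> 1 + (1 - \<rho>) / g * d"
  shows "real N \<le> 3 * (1 / \<epsilon>\<^sup>2)"
proof -
  have "(1 - \<rho>) / g \<le> 1 / (7 / 8 * \<epsilon>)" using assms by (intro frac_le) auto
  then have "(1 - \<rho>) / g * d \<le> 1 / (7 / 8 * \<epsilon>) * (8 / (7 * \<epsilon>))"
    using assms by (intro mult_mono) auto
  also have "\<dots> = 64 / 49 * (1 / \<epsilon>\<^sup>2)" by (simp add: power2_eq_square)
  finally have "real N \<le> 1 + 64 / 49 * (1 / \<epsilon>\<^sup>2)" using assms by simp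
  moreover have "\<epsilon>\<^sup>2 \<le> 1" using assms by (simp add: power_le_one)
  then have "1 \<le> 1 / \<epsilon>\<^sup>2" using assms by simp
  ultimately show ?thesis by simp
qed

lemma large_list_size:
  fixes N l :: nat and \<rho> \<epsilon> \<tau> :: real
  assumes "0 < \<epsilon>" "\<epsilon> \<le> \<rho>" "\<rho> \<le> 1" "7 / 8 * \<epsilon> \<le> \<rho> - \<tau>" and l: "2 \<le> l" and N: "0 < N"
    and bound: "exp (-1) \<le> \<rho> * real N / real l \<Longrightarrow> \<rho> * ln (\<rho> * real N / real l) \<le> \<tau> * ln (real N)"
  shows "real N \<le> 3 * (real l / \<epsilon>\<^sup>2) * real l powr (2 * ln (2 * exp 1 * real l / \<rho>) * (\<rho> / \<epsilon>))"
proof -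
  define E where "E = 2 * ln (2 * exp 1 * real l / \<rho>) * (\<rho> / \<epsilon>)"
  have \<rho>: "0 < \<rho>" using assms by simp
  have e1: "1 \<le> exp (1::real)" by simp
  have lr: "1 \<le> real l / \<rho>" using l assms(3) \<rho> by simp
  have ln_le: "ln (real l / \<rho>) \<le> ln (2 * exp 1 * real l / \<rho>)"
  proof (rule ln_mono)
    have "1 \<le> 2 * exp (1::real)" using e1 by linarith
    then have "1 * (real l / \<rho>) \<le> (2 * exp 1) * (real l / \<rho>)" using lr by (intro mult_right_mono) auto
    then show "real l / \<rho> \<le> 2 * exp 1 * real l / \<rho>" by simp
  qed (use lr in auto)
  have ln0: "0 \<le> ln (real l / \<rho>)" using lr by simp
  have "0 \<le> ln (2 * exp 1 * real l / \<rho>)" using ln_le ln0 by linarith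
  then have E0: "0 \<le> E" using assms(1) \<rho> by (simp only: E_def) simp
  have pw: "1 \<le> real l powr E" using E0 l by (simp add: ge_one_powr_ge_zero)
  have "\<epsilon>\<^sup>2 \<le> \<epsilon>" using assms by (simp add: power2_eq_square mult_left_le)
  then have e2: "\<epsilon>\<^sup>2 \<le> \<rho>" "\<epsilon>\<^sup>2 \<le> 1" "0 < \<epsilon>\<^sup>2" using assms by auto
  show ?thesis
  proof (cases "exp (-1) \<le> \<rho> * real N / real l")
    case False
    then have "\<rho> * real N / real l \<le> 1" using exp_le_one_iff[of "-1::real"] by linarith
    then have "real N \<le> real l / \<rho>" using \<rho> l by (simp add: field_simps)
    also have "\<dots> \<le> real l / \<epsilon>\<^sup>2" using e2 \<rho> mult_pos_pos[OF \<rho> e2(3)] by (intro divide_left_mono) auto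
    also have "\<dots> \<le> 3 * (real l / \<epsilon>\<^sup>2)"
      using divide_nonneg_pos[OF of_nat_0_le_iff[of l] e2(3)] by linarith
    also have "\<dots> \<le> 3 * (real l / \<epsilon>\<^sup>2) * real l powr E"
      using mult_left_mono[OF pw, of "3 * (real l / \<epsilon>\<^sup>2)"] by simp
    finally show ?thesis by (simp add: E_def)
  next
    case True
    have lnN: "0 \<le> ln (real N)" using N by simp
    have "ln (real N) = ln (\<rho> * real N / real l) + ln (real l / \<rho>)"
      using \<rho> N l by (simp add: ln_mult ln_div)
    then have "\<rho> * ln (real N) = \<rho> * ln (\<rho> * real N / real l) + \<rho> * ln (real l / \<rho>)"
      by (simp only: distrib_left)
    then have "(\<rho> - \<tau>) * ln (real N) \<le> \<rho> * ln (real l / \<rho>)"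
      using bound[OF True] by (simp only: left_diff_distrib)
    moreover have "7 / 8 * \<epsilon> * ln (real N) \<le> (\<rho> - \<tau>) * ln (real N)"
      using assms lnN by (intro mult_right_mono) auto
    ultimately have "7 / 8 * \<epsilon> * ln (real N) \<le> \<rho> * ln (real l / \<rho>)" by simp
    then have "ln (real N) \<le> 2 * (4 / 7) * ln (real l / \<rho>) * (\<rho> / \<epsilon>)"
      using assms(1) by (simp add: field_simps)
    also have "\<dots> \<le> 2 * (4 / 7) * ln (2 * exp 1 * real l / \<rho>) * (\<rho> / \<epsilon>)"
      using ln_le assms \<rho> by (intro mult_right_mono mult_left_mono) auto
    also have "\<dots> = 4 / 7 * E" by (simp add: E_def)
    also have "\<dots> \<le> ln (real l) * E"
    proof (rule mult_right_mono[OF _ E0])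
      \<comment> \<open>1 + x + x^2 at x = 4/7 is below 2.\<close>
      have "exp (4 / 7) \<le> (2::real)"
        using exp_bound[of "4 / 7"] by (simp add: power2_eq_square)
      then have "4 / 7 \<le> ln (2::real)" by (subst ln_ge_iff) simp_all
      also have "\<dots> \<le> ln (real l)" using l by simp
      finally show "4 / 7 \<le> ln (real l)" .
    qed
    finally have "exp (ln (real N)) \<le> exp (ln (real l) * E)" by simp
    then have "real N \<le> exp (ln (real l) * E)" using N by simp
    then have "real N \<le> real l powr E" using l by (simp add: powr_def mult.commute)
    also have "\<dots> \<le> 3 * (real l / \<epsilon>\<^sup>2) * real l powr E"
    proof -
      have "1 \<le> real l / \<epsilon>\<^sup>2" using e2 l by (simp add: le_divide_eq)
      then have "1 * real l powr E \<le> 3 * (real l / \<epsilon>\<^sup>2) * real l powr E"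
        by (intro mult_right_mono) auto
      then show ?thesis by simp
    qed
    finally show ?thesis by (simp add: E_def)
  qed
qed

lemma (in folded_code) list_recovery_bound:
  assumes l: "0 < l" and \<epsilon>: "0 < \<epsilon>" and R_pos: "0 < r"
    and rate: "code_rate (words s (carrier R)) n (folded_rs R n k s \<gamma> \<alpha>) = r"
    and s: "16 * (r + \<epsilon>) * real l / \<epsilon>\<^sup>2 < real s"
    and L: "\<And>i. i < n \<Longrightarrow> L i \<subseteq> words s (carrier R) \<and> card (L i) = l"
  shows "real (card {c \<in> folded_rs R n k s \<gamma> \<alpha>. rel_dist_set n c (PiE {..<n} L) \<le> 1 - r - \<epsilon>})
    \<le> 3 * (real l / \<epsilon>\<^sup>2) * real l powr (2 * ln (2 * exp 1 * real l / (r + \<epsilon>)) * ((r + \<epsilon>) / \<epsilon>))"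
    (is "real (card ?C) \<le> ?B")
proof -
  define \<rho> where "\<rho> = r + \<epsilon>"
  define S where "S = {f \<in> polys k. \<rho> * real n \<le> real (card {i \<in> {..<n}. symbol i f \<in> L i})}"
  have finL: "finite (L i) \<and> card (L i) = l" if "i < n" for i
    using L[OF that] l card_ge_0_finite by auto
  have finS: "finite S" by (simp add: S_def finite_polys)
  have B0: "0 \<le> ?B" by simp
  have "?C \<subseteq> encode ` S"
  proof
    fix c assume "c \<in> ?C"
    then obtain f where f: "f \<in> polys k" "c = encode f"
      and dist: "rel_dist_set n c (PiE {..<n} L) \<le> 1 - \<rho>"
      by (auto simp: folded_rs_eq \<rho>_def diff_diff_eq)
    \<comment> \<open>Nonempty lists are what makes the distance to the product equal to the
      fraction of disagreeing coordinates.\<close>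
    have ne: "L i \<noteq> {}" if "i < n" for i using finL[OF that] l by auto
    have "real (card {i \<in> {..<n}. c i \<notin> L i}) / real n \<le> 1 - \<rho>"
      using dist rel_dist_set_product[OF ne] by simp
    then have "real (card {i \<in> {..<n}. c i \<notin> L i}) \<le> (1 - \<rho>) * real n"
      by (subst (asm) pos_divide_le_eq) (use n_pos in simp_all)
    then have "real (card {i \<in> {..<n}. c i \<notin> L i}) \<le> real n - \<rho> * real n"
      by (simp add: left_diff_distrib)
    moreover have "card {i \<in> {..<n}. c i \<notin> L i} + card {i \<in> {..<n}. c i \<in> L i} = n"
    proof -
      have "card ({i \<in> {..<n}. c i \<notin> L i} \<union> {i \<in> {..<n}. c i \<in> L i}) = card {..<n}"
        by (rule arg_cong[of _ _ card]) auto
      then show ?thesis by (subst (asm) card_Un_disjoint) auto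
    qed
    ultimately have "\<rho> * real n \<le> real (card {i \<in> {..<n}. c i \<in> L i})" by linarith
    moreover have "{i \<in> {..<n}. c i \<in> L i} = {i \<in> {..<n}. symbol i f \<in> L i}"
      by (auto simp: f(2) encode_def)
    ultimately show "c \<in> encode ` S" using f by (auto simp: S_def)
  qed
  then have "card ?C \<le> card S"
    using finS by (meson card_image_le card_mono finite_imageI order_trans)
  moreover have "real (card S) \<le> ?B"
  proof (cases "S = {}")
    case True
    then show ?thesis using B0 by simp
  next
    case False
    then obtain f where "f \<in> S" by blast
    then have "\<rho> * real n \<le> real (card {i \<in> {..<n}. symbol i f \<in> L i})" by (simp add: S_def)
    also have "\<dots> \<le> real (card {..<n})" by (intro of_nat_mono card_mono) auto
    finally have \<rho>1: "\<rho> \<le> 1" using n_pos by simp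
    have rate_ge: "real (min k (s * n)) / real (s * n) \<le> r" using code_rate_ge rate by simp
    \<comment> \<open>k \<ge> s n would make the rate at least 1, against r = \<rho> - \<epsilon> <
      1. Once k < s n, the minima in the order condition and in the rate bound are both
      \<open>k\<close>.\<close>
    have k_lt: "k < s * n"
    proof (rule ccontr)
      assume "\<not> k < s * n"
      then have "1 \<le> r" using rate_ge s_pos n_pos by (simp add: min_def split: if_splits)
      then show False using \<rho>1 \<epsilon> by (simp add: \<rho>_def)
    qed
    then have k_ord: "k \<le> ord_\<gamma>" using min_le_ord by simp
    \<comment> \<open>The least \<open>D\<close> with (7/8) \<epsilon> D \<ge> l, as confining the
      list to a small subspace requires for a gap \<rho> - \<tau> of at least (7/8)
      \<epsilon>.\<close>
    define D where "D = nat \<lceil>8 * real l / (7 * \<epsilon>)\<rceil>"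
    have D: "8 * real l / (7 * \<epsilon>) \<le> real D" "real D - 1 \<le> 8 * real l / (7 * \<epsilon>)"
    proof -
      have "0 \<le> 8 * real l / (7 * \<epsilon>)" using \<epsilon> by simp
      then show "8 * real l / (7 * \<epsilon>) \<le> real D" "real D - 1 \<le> 8 * real l / (7 * \<epsilon>)"
        unfolding D_def by linarith+
    qed
    define \<tau> where "\<tau> = real k / (real n * real (s - D + 1))"
    have gap: "D \<le> s" "7 / 8 * \<epsilon> \<le> \<rho> - \<tau>"
      unfolding \<rho>_def \<tau>_def
      using design_gap[OF n_pos s_pos l R_pos \<epsilon> _ _ s D(2), of k] \<rho>1 rate_ge k_lt
      by (auto simp: \<rho>_def)
    interpret sd: subspace_design R P "polys k" n H symbol D \<tau>
      unfolding \<tau>_def by (rule subspace_design_folded[OF gap(1) k_ord])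
    have S: "S \<subseteq> polys k" by (auto simp: S_def)
    have agree: "\<rho> * real n \<le> real (card {i \<in> {..<n}. symbol i x \<in> L i})" if "x \<in> S" for x
      using that by (simp add: S_def)
    have \<tau>_lt: "\<tau> < \<rho>" using gap(2) \<epsilon> by simp
    note ctx = S False finL agree \<tau>_lt
    have "real l \<le> real D * (7 / 8 * \<epsilon>)" using D(1) \<epsilon> by (simp add: field_simps)
    also have "\<dots> \<le> real D * (\<rho> - \<tau>)" using gap(2) by (intro mult_left_mono) auto
    also have "\<dots> < real D * (\<rho> - \<tau>) + \<rho>" using R_pos \<epsilon> by (simp add: \<rho>_def)
    finally have "real l < real D * (\<rho> - \<tau>) + \<rho>" .
    then obtain U where U: "U \<in> vs.subspaces" "vs.vdim U < D"
      "\<And>x y. x \<in> S \<Longrightarrow> y \<in> S \<Longrightarrow> x \<ominus>\<^bsub>P\<^esub> y \<in> U"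
      using sd.list_in_small_subspace[OF ctx] by metis
    have \<epsilon>\<rho>: "\<epsilon> \<le> \<rho>" using R_pos by (simp add: \<rho>_def)
    show ?thesis
    proof (cases "l = 1")
      case True
      have "real (card S) \<le> 1 + (1 - \<rho>) / (\<rho> - \<tau>) * real (vs.vdim U)"
        using sd.unique_list_bound[OF ctx True \<rho>1 U(1) _ order_refl] U by simp
      from unique_list_size[OF \<epsilon> \<epsilon>\<rho> \<rho>1 gap(2) _ _ this]
      have "real (card S) \<le> 3 * (1 / \<epsilon>\<^sup>2)" using U(2) D(2) True by simp
      then show ?thesis using True by simp
    next
      case False
      then have "2 \<le> l" using l by simp
      moreover have "0 < card S" using \<open>S \<noteq> {}\<close> finS by (simp add: card_gt_0_iff)
      moreover have "\<rho> * ln (\<rho> * real (card S) / real l) \<le> \<tau> * ln (real (card S))"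
        if "exp (-1) \<le> \<rho> * real (card S) / real l"
        using sd.list_entropy_bound[OF ctx U(1) _ U(3) l that] U(2) by simp
      ultimately show ?thesis
        using large_list_size[OF \<epsilon> \<epsilon>\<rho> \<rho>1 gap(2)] unfolding \<rho>_def by blast
    qed
  qed
  ultimately show ?thesis by linarith
qed

lemma folded_codeI:
  fixes F (structure)
  assumes "folded_rs_params F n k s \<gamma> \<alpha>"
  shows "folded_code F n k s \<gamma> \<alpha>"
proof -
  have p: "field F" "finite (carrier F)" "0 < n" "0 < k" "0 < s"
     "\<gamma> \<in> carrier F" "\<alpha> \<in> {..<n} \<rightarrow> carrier F"
     "\<And>i j t. i < n \<Longrightarrow> j < n \<Longrightarrow> t < s \<Longrightarrow> i \<noteq> j \<Longrightarrow> \<alpha> i \<otimes> (\<gamma> [^] t) \<noteq> \<alpha> j"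
     "\<And>i. i < n \<Longrightarrow> \<alpha> i \<noteq> \<zero>" "\<gamma> \<noteq> \<zero>"
     "min k (s * n) \<le> group.ord (Multiplicative_Group.mult_of F) \<gamma>"
    using assms
    by (auto simp: folded_rs_params_def Ring_Divisibility.mult_of_def Multiplicative_Group.mult_of_def)
  interpret field F by (rule p(1))
  show ?thesis
    by unfold_locales (use p in \<open>auto simp: Pi_iff\<close>)
qed

theorem theorem4p3:
  shows "\<exists>C::real. C > 0 \<and>
    (\<forall>(F :: 'a ring) n k s \<gamma> \<alpha> (l::nat) (\<epsilon>::real) (R::real) L.
       folded_rs_params F n k s \<gamma> \<alpha> \<longrightarrow>
       l > 0 \<longrightarrow> \<epsilon> > 0 \<longrightarrow> R > 0 \<longrightarrow>
       code_rate (words s (carrier F)) n (folded_rs F n k s \<gamma> \<alpha>) = R \<longrightarrow>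
       real s > 16 * (R + \<epsilon>) * real l / \<epsilon>\<^sup>2 \<longrightarrow>
       (\<forall>i<n. L i \<subseteq> words s (carrier F) \<and> card (L i) = l) \<longrightarrow>
       real (card {c \<in> folded_rs F n k s \<gamma> \<alpha>. rel_dist_set n c (PiE {..<n} L) \<le> 1 - R - \<epsilon>})
         \<le> C * (real l / \<epsilon>\<^sup>2)
             * real l powr (2 * ln (2 * exp 1 * real l / (R + \<epsilon>)) * ((R + \<epsilon>) / \<epsilon>)))"
proof (intro exI[of _ 3] conjI allI impI)
  fix F :: "'a ring" and n k s \<gamma> \<alpha> and l :: nat and \<epsilon> R :: real and L
  assume params: "folded_rs_params F n k s \<gamma> \<alpha>"
    and pos: "l > 0" "\<epsilon> > 0" "R > 0"
    and rate: "code_rate (words s (carrier F)) n (folded_rs F n k s \<gamma> \<alpha>) = R"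
    and s: "real s > 16 * (R + \<epsilon>) * real l / \<epsilon>\<^sup>2"
    and L: "\<forall>i<n. L i \<subseteq> words s (carrier F) \<and> card (L i) = l"
  show "real (card {c \<in> folded_rs F n k s \<gamma> \<alpha>. rel_dist_set n c (PiE {..<n} L) \<le> 1 - R - \<epsilon>})
    \<le> 3 * (real l / \<epsilon>\<^sup>2)
      * real l powr (2 * ln (2 * exp 1 * real l / (R + \<epsilon>)) * ((R + \<epsilon>) / \<epsilon>))"
    using folded_code.list_recovery_bound[OF folded_codeI[OF params] pos rate s] L by blast
qed simp

end
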